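(* Let $\mathbb{F}$ be an arbitrary field and let $\mathcal{O}$ be an Okubo algebra over $\mathbb{F}$ without nonzero idempotents and without zero divisors. Then $l(\mathcal{O}) = 3$.
   Context: Algebras over $\mathbb{F}$ are vector spaces with a bilinear multiplication, not necessarily unital or associative. A nonzero idempotent is an element $c\neq 0$ with $c c=c$; a zero divisor is a nonzero element $a$ for which there is a nonzero $b$ with $ab=0$ or $ba=0$. Okubo algebras: let $\overline{\mathbb{F}}$ be an algebraic closure of $\mathbb{F}$. Let $\mathcal{S}$ be the $8$-dimensional algebra over $\overline{\mathbb{F}}$ with basis $x_{i,j}$, $i,j\in\{-1,0,1\}$, $(i,j)\ne(0,0)$, and the following multiplication. Write $\overline{x_{i,j}}=x_{-i,-j}$. For every basis element $u$, $u*u=-\overline{u}$. For each of the eight triples $(u,v,w)$: $(x_{1,0},x_{0,-1},x_{-1,1})$, $(x_{1,0},x_{-1,-1},x_{0,1})$, $(x_{1,0},x_{1,-1},x_{1,1})$, $(x_{-1,0},x_{0,1},x_{1,-1})$, $(x_{-1,0},x_{1,1},x_{0,-1})$, $(x_{-1,0},x_{-1,1},x_{-1,-1})$, $(x_{0,1},x_{1,1},x_{-1,1})$, $(x_{0,-1},x_{-1,-1},x_{1,-1})$, one has $u*v=\overline{w}$, $v*w=\overline{u}$, $w*u=\overline{v}$. All other products of basis elements are $0$. An Okubo algebra over $\mathbb{F}$ is an $\mathbb{F}$-algebra $\mathcal{O}$ with $\mathcal{O}\otimes_{\mathbb{F}}\overline{\mathbb{F}}\cong\mathcal{S}$. (If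 $\operatorname{char}\mathbb{F}\ne2,3$, then $\mathcal{S}$ is isomorphic to the pseudo-octonion algebra $P_8(\overline{\mathbb{F}})$: the space of trace zero $3\times3$ matrices with $x*y=\mu xy+(1-\mu)yx-\frac{\operatorname{tr}(xy)}{3}I$, where $3\mu(1-\mu)=1$.) Every Okubo algebra is $8$-dimensional and non-unital. Length: let $\mathcal{B}$ be a finite-dimensional algebra and $S\subseteq\mathcal{B}$. For $k\ge1$, a word of length $k$ in $S$ is any product of $k$ elements of $S$, with any arrangement of brackets; if $\mathcal{B}$ is unital, its unity is the word of length $0$, and if $\mathcal{B}$ is not unital there are no words of length $0$. $\mathcal{L}_k(S)$ is the linear span of all words of length at most $k$ in $S$ (so $\mathcal{L}_0(S)=\{0\}$ if $\mathcal{B}$ is non-unital), and $\mathcal{L}_\infty(S)=\bigcup_k\mathcal{L}_k(S)$. $S$ is generating if $\mathcal{L}_\infty(S)=\mathcal{B}$. $l(S)=\min\{k\ge 0:\mathcal{L}_k(S)=\mathcal{L}_\infty(S)\}$, and $l(\mathcal{B})=\max\{l(S): S \text{ generating for } \mathcal{B}\}$. *)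

theory Defs
  imports
    "HOL-Analysis.Cartesian_Space"
    "HOL-Library.Poly_Mapping"
    "HOL-Algebra.Algebraic_Closure_Type"
begin

section \<open>Algebras, not necessarily unital or associative\<close>

locale nonassoc_algebra = vector_space scale
  for scale :: "'f::field \<Rightarrow> 'v::ab_group_add \<Rightarrow> 'v" (infixr \<open>*\<^sub>S\<close> 75) +
  fixes mult :: "'v \<Rightarrow> 'v \<Rightarrow> 'v" (infixl \<open>\<star>\<close> 70)
  assumes mult_add_left: "(x + y) \<star> z = x \<star> z + y \<star> z"
    and mult_add_right: "x \<star> (y + z) = x \<star> y + x \<star> z"
    and mult_scale_left: "(a *\<^sub>S x) \<star> y = a *\<^sub>S (x \<star> y)"
    and mult_scale_right: "x \<star> (a *\<^sub>S y) = a *\<^sub>S (x \<star> y)"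
begin

definition is_idempotent :: "'v \<Rightarrow> bool"
  where "is_idempotent c \<longleftrightarrow> c \<star> c = c"

definition is_zero_divisor :: "'v \<Rightarrow> bool"
  where "is_zero_divisor a \<longleftrightarrow> a \<noteq> 0 \<and> (\<exists>b. b \<noteq> 0 \<and> (a \<star> b = 0 \<or> b \<star> a = 0))"

definition is_unity :: "'v \<Rightarrow> bool"
  where "is_unity e \<longleftrightarrow> (\<forall>x. e \<star> x = x \<and> x \<star> e = x)"

subsection \<open>Length\<close>

text \<open>\<open>is_word S k w\<close>: \<open>w\<close> is the value of a word of length \<open>k\<close> in \<open>S\<close>.
  If there is no unity, then no word has length 0.\<close>

inductive is_word :: "'v set \<Rightarrow> nat \<Rightarrow> 'v \<Rightarrow> bool" for S :: "'v set" where
  unity: "is_unity e \<Longrightarrow> is_word S 0 e"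
| letter: "s \<in> S \<Longrightarrow> is_word S 1 s"
| product: "is_word S m a \<Longrightarrow> is_word S n b \<Longrightarrow> m \<ge> 1 \<Longrightarrow> n \<ge> 1 \<Longrightarrow> is_word S (m + n) (a \<star> b)"

definition word_span :: "nat \<Rightarrow> 'v set \<Rightarrow> 'v set"
  where "word_span k S = span {w. \<exists>j\<le>k. is_word S j w}"

definition word_span_inf :: "'v set \<Rightarrow> 'v set"
  where "word_span_inf S = (\<Union>k. word_span k S)"

definition generating :: "'v set \<Rightarrow> bool"
  where "generating S \<longleftrightarrow> word_span_inf S = UNIV"

definition set_length :: "'v set \<Rightarrow> nat"
  where "set_length S = (LEAST k. word_span k S = word_span_inf S)"

definition algebra_length :: nat
  where "algebra_length = Max {set_length S | S. generating S}"

end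


section \<open>Extension of scalars to the algebraic closure\<close>

text \<open>A finitely supported function \<open>p :: 'v \<Rightarrow>\<^sub>0 'k\<close> stands for the formal sum of the symbols
  \<open>v \<otimes> lookup p v\<close>, and \<open>single v c\<close> for the symbol \<open>v \<otimes> c\<close>. Symbols are thus additive in the
  second argument from the start; the tensor product is the quotient of the group of formal sums
  by the remaining relations.\<close>

definition formal_scale :: "'k::field \<Rightarrow> ('v \<Rightarrow>\<^sub>0 'k) \<Rightarrow> ('v \<Rightarrow>\<^sub>0 'k)"
  where "formal_scale c p = Poly_Mapping.map ((*) c) p"

definition formal_mult ::
    "('v \<Rightarrow> 'v \<Rightarrow> 'v) \<Rightarrow> ('v \<Rightarrow>\<^sub>0 'k::field) \<Rightarrow> ('v \<Rightarrow>\<^sub>0 'k) \<Rightarrow> ('v \<Rightarrow>\<^sub>0 'k)"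
  where "formal_mult m p q =
    (\<Sum>u\<in>Poly_Mapping.keys p. \<Sum>v\<in>Poly_Mapping.keys q.
      Poly_Mapping.single (m u v) (Poly_Mapping.lookup p u * Poly_Mapping.lookup q v))"

context nonassoc_algebra
begin

inductive_set tensor_null :: "('v \<Rightarrow>\<^sub>0 'f alg_closure) set" where
  zero: "0 \<in> tensor_null"
| additive: "Poly_Mapping.single (u + v) c - Poly_Mapping.single u c - Poly_Mapping.single v c \<in> tensor_null"
| balanced: "Poly_Mapping.single (a *\<^sub>S u) c - Poly_Mapping.single u (to_ac a * c) \<in> tensor_null"
| diff: "p \<in> tensor_null \<Longrightarrow> q \<in> tensor_null \<Longrightarrow> p - q \<in> tensor_null"

definition tensor_class :: "('v \<Rightarrow>\<^sub>0 'f alg_closure) \<Rightarrow> ('v \<Rightarrow>\<^sub>0 'f alg_closure) set"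
  where "tensor_class p = {q. p - q \<in> tensor_null}"

definition ext_carrier :: "('v \<Rightarrow>\<^sub>0 'f alg_closure) set set"
  where "ext_carrier = range tensor_class"

text \<open>The operations are defined through representatives; that they do not depend on the choice
  is shown in \<open>ext_add_class\<close>, \<open>ext_scale_class\<close> and \<open>ext_mult_class\<close>.\<close>

definition ext_add where
  "ext_add A B = (\<Union>p\<in>A. \<Union>q\<in>B. tensor_class (p + q))"

definition ext_scale where
  "ext_scale c A = (\<Union>p\<in>A. tensor_class (formal_scale c p))"

definition ext_mult where
  "ext_mult A B = (\<Union>p\<in>A. \<Union>q\<in>B. tensor_class (formal_mult mult p q))"

lemma tensor_null_uminus: "p \<in> tensor_null \<Longrightarrow> - p \<in> tensor_null"
  using tensor_null.diff[OF tensor_null.zero] by simp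

lemma tensor_null_add:
  assumes "p \<in> tensor_null" "q \<in> tensor_null"
  shows "p + q \<in> tensor_null"
  using tensor_null.diff[OF assms(1) tensor_null_uminus[OF assms(2)]] by simp

lemma tensor_null_sum: "(\<And>i. i \<in> I \<Longrightarrow> f i \<in> tensor_null) \<Longrightarrow> sum f I \<in> tensor_null"
  by (induction I rule: infinite_finite_induct) (auto intro: tensor_null.zero tensor_null_add)

lemma tensor_class_eq_iff: "tensor_class p = tensor_class q \<longleftrightarrow> p - q \<in> tensor_null"
proof
  have "q \<in> tensor_class q" by (simp add: tensor_class_def tensor_null.zero)
  then show "tensor_class p = tensor_class q \<Longrightarrow> p - q \<in> tensor_null"
    by (auto simp: tensor_class_def)
next
  assume pq: "p - q \<in> tensor_null"
  have "p - r \<in> tensor_null \<longleftrightarrow> q - r \<in> tensor_null" for r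
  proof
    assume "p - r \<in> tensor_null"
    from tensor_null.diff[OF this pq] show "q - r \<in> tensor_null" by simp
  next
    assume "q - r \<in> tensor_null"
    from tensor_null_add[OF pq this] show "p - r \<in> tensor_null" by simp
  qed
  then show "tensor_class p = tensor_class q" by (simp add: tensor_class_def)
qed

lemma in_tensor_class_iff: "q \<in> tensor_class p \<longleftrightarrow> tensor_class q = tensor_class p"
  by (metis tensor_class_eq_iff tensor_class_def mem_Collect_eq)

lemma lookup_formal_scale [simp]:
  "Poly_Mapping.lookup (formal_scale c p) v = c * Poly_Mapping.lookup p v"
  by (simp add: formal_scale_def Poly_Mapping.map.rep_eq when_def)

lemma formal_scale_diff: "formal_scale c (p - q) = formal_scale c p - formal_scale c q"
  by (rule poly_mapping_eqI) (simp add: lookup_minus algebra_simps)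

lemma formal_scale_single: "formal_scale c (Poly_Mapping.single v d) = Poly_Mapping.single v (c * d)"
  by (rule poly_mapping_eqI) (simp add: lookup_single when_def)

lemma formal_scale_null: "p \<in> tensor_null \<Longrightarrow> formal_scale c p \<in> tensor_null"
proof (induction rule: tensor_null.induct)
  case zero
  have "formal_scale c 0 = (0 :: 'v \<Rightarrow>\<^sub>0 'f alg_closure)" by (rule poly_mapping_eqI) simp
  then show ?case by (simp add: tensor_null.zero)
next
  case (additive u v d)
  then show ?case by (simp add: formal_scale_diff formal_scale_single tensor_null.additive)
next
  case (balanced a u d)
  show ?case
    using tensor_null.balanced[of a u "c * d"]
    by (simp add: formal_scale_diff formal_scale_single mult.left_commute)
next
  case (diff p q)
  then show ?case by (simp add: formal_scale_diff tensor_null.diff)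
qed

lemma formal_mult_superset:
  assumes "finite A" "finite B" "Poly_Mapping.keys p \<subseteq> A" "Poly_Mapping.keys q \<subseteq> B"
  shows "formal_mult m p q = (\<Sum>u\<in>A. \<Sum>v\<in>B.
    Poly_Mapping.single (m u v) (Poly_Mapping.lookup p u * Poly_Mapping.lookup q v))"
proof -
  have "formal_mult m p q = (\<Sum>u\<in>Poly_Mapping.keys p. \<Sum>v\<in>B.
      Poly_Mapping.single (m u v) (Poly_Mapping.lookup p u * Poly_Mapping.lookup q v))"
    unfolding formal_mult_def
    by (intro sum.cong refl sum.mono_neutral_left) (use assms in \<open>auto simp: in_keys_iff\<close>)
  also have "\<dots> = (\<Sum>u\<in>A. \<Sum>v\<in>B.
      Poly_Mapping.single (m u v) (Poly_Mapping.lookup p u * Poly_Mapping.lookup q v))"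
    by (intro sum.mono_neutral_left) (use assms in \<open>auto simp: in_keys_iff\<close>)
  finally show ?thesis .
qed

lemma formal_mult_diff_left: "formal_mult m (p - p') q = formal_mult m p q - formal_mult m p' q"
proof -
  let ?A = "Poly_Mapping.keys p \<union> Poly_Mapping.keys p' \<union> Poly_Mapping.keys (p - p')"
  have "formal_mult m r q = (\<Sum>u\<in>?A. \<Sum>v\<in>Poly_Mapping.keys q.
      Poly_Mapping.single (m u v) (Poly_Mapping.lookup r u * Poly_Mapping.lookup q v))"
    if "r \<in> {p, p', p - p'}" for r
    by (rule formal_mult_superset) (use that in auto)
  then show ?thesis
    by (simp add: lookup_minus left_diff_distrib single_diff sum_subtractf)
qed

lemma formal_mult_diff_right: "formal_mult m p (q - q') = formal_mult m p q - formal_mult m p q'"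
proof -
  let ?B = "Poly_Mapping.keys q \<union> Poly_Mapping.keys q' \<union> Poly_Mapping.keys (q - q')"
  have "formal_mult m p r = (\<Sum>u\<in>Poly_Mapping.keys p. \<Sum>v\<in>?B.
      Poly_Mapping.single (m u v) (Poly_Mapping.lookup p u * Poly_Mapping.lookup r v))"
    if "r \<in> {q, q', q - q'}" for r
    by (rule formal_mult_superset) (use that in auto)
  then show ?thesis
    by (simp add: lookup_minus right_diff_distrib single_diff sum_subtractf)
qed

lemma formal_mult_single_left:
  "formal_mult m (Poly_Mapping.single u c) q =
    (\<Sum>v\<in>Poly_Mapping.keys q. Poly_Mapping.single (m u v) (c * Poly_Mapping.lookup q v))"
  by (subst formal_mult_superset[of "{u}" "Poly_Mapping.keys q"]) auto

lemma formal_mult_single_right: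
  "formal_mult m p (Poly_Mapping.single v c) =
    (\<Sum>u\<in>Poly_Mapping.keys p. Poly_Mapping.single (m u v) (Poly_Mapping.lookup p u * c))"
  by (subst formal_mult_superset[of "Poly_Mapping.keys p" "{v}"]) auto

lemma formal_mult_null_left: "p \<in> tensor_null \<Longrightarrow> formal_mult mult p q \<in> tensor_null"
proof (induction rule: tensor_null.induct)
  case zero
  then show ?case by (simp add: formal_mult_def tensor_null.zero)
next
  case (additive u v c)
  show ?case
    unfolding formal_mult_diff_left formal_mult_single_left sum_subtractf[symmetric] mult_add_left
    by (intro tensor_null_sum tensor_null.additive)
next
  case (balanced a u c)
  show ?case
    unfolding formal_mult_diff_left formal_mult_single_left sum_subtractf[symmetric] mult_scale_left
      mult.assoc
    by (intro tensor_null_sum tensor_null.balanced)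
next
  case (diff p q)
  then show ?case by (simp add: formal_mult_diff_left tensor_null.diff)
qed

lemma formal_mult_null_right: "q \<in> tensor_null \<Longrightarrow> formal_mult mult p q \<in> tensor_null"
proof (induction rule: tensor_null.induct)
  case zero
  then show ?case by (simp add: formal_mult_def tensor_null.zero)
next
  case (additive u v c)
  show ?case
    unfolding formal_mult_diff_right formal_mult_single_right sum_subtractf[symmetric] mult_add_right
    by (intro tensor_null_sum tensor_null.additive)
next
  case (balanced a u c)
  show ?case
    unfolding formal_mult_diff_right formal_mult_single_right sum_subtractf[symmetric] mult_scale_right
      mult.left_commute[of _ "to_ac a"]
    by (intro tensor_null_sum tensor_null.balanced)
next
  case (diff p q)
  then show ?case by (simp add: formal_mult_diff_right tensor_null.diff)
qed

lemma self_in_tensor_class: "p \<in> tensor_class p"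
  by (simp add: in_tensor_class_iff)

lemma ext_add_class: "ext_add (tensor_class p) (tensor_class q) = tensor_class (p + q)"
proof -
  have "tensor_class (p' + q') = tensor_class (p + q)"
    if "p' \<in> tensor_class p" "q' \<in> tensor_class q" for p' q'
    using tensor_null_add[of "p' - p" "q' - q"] that
    by (simp add: in_tensor_class_iff tensor_class_eq_iff algebra_simps)
  then show ?thesis
    unfolding ext_add_def using self_in_tensor_class[of p] self_in_tensor_class[of q] by blast
qed

lemma ext_scale_class: "ext_scale c (tensor_class p) = tensor_class (formal_scale c p)"
proof -
  have "tensor_class (formal_scale c p') = tensor_class (formal_scale c p)"
    if "p' \<in> tensor_class p" for p'
    using formal_scale_null[of "p' - p" c] that
    by (simp add: in_tensor_class_iff tensor_class_eq_iff formal_scale_diff)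
  then show ?thesis
    unfolding ext_scale_def using self_in_tensor_class[of p] by blast
qed

lemma ext_mult_class:
  "ext_mult (tensor_class p) (tensor_class q) = tensor_class (formal_mult mult p q)"
proof -
  have "tensor_class (formal_mult mult p' q') = tensor_class (formal_mult mult p q)"
    if "p' \<in> tensor_class p" "q' \<in> tensor_class q" for p' q'
  proof -
    have "p' - p \<in> tensor_null" "q' - q \<in> tensor_null"
      using that by (simp_all add: in_tensor_class_iff tensor_class_eq_iff)
    from tensor_null_add[OF formal_mult_null_left[OF this(1), of q'] formal_mult_null_right[OF this(2), of p]]
    show ?thesis
      by (simp add: formal_mult_diff_left formal_mult_diff_right tensor_class_eq_iff)
  qed
  then show ?thesis
    unfolding ext_mult_def using self_in_tensor_class[of p] self_in_tensor_class[of q] by blast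
qed

end


section \<open>Okubo algebras\<close>

typedef okubo_index = "{-1, 0, 1 :: int} \<times> {-1, 0, 1 :: int} - {(0, 0)}"
  by (intro exI[of _ "(1, 0)"]) simp

instance okubo_index :: finite
proof
  show "finite (UNIV :: okubo_index set)"
    unfolding type_definition.univ[OF type_definition_okubo_index]
    by (intro finite_imageI finite_Diff finite_cartesian_product) simp_all
qed

definition okubo_bar :: "okubo_index \<Rightarrow> okubo_index"
  where "okubo_bar u = Abs_okubo_index (map_prod uminus uminus (Rep_okubo_index u))"

text \<open>The split Okubo algebra lives on the coordinate space over \<open>okubo_index\<close>; its basis element
  \<open>x\<^sub>i\<^sub>j\<close> is \<open>axis (Abs_okubo_index (i, j)) 1\<close>. A triple \<open>(a, b, c)\<close> of indices stands for the three
  products \<open>x\<^sub>a * x\<^sub>b = x\<^sub>-\<^sub>c\<close>, \<open>x\<^sub>b * x\<^sub>c = x\<^sub>-\<^sub>a\<close>, \<open>x\<^sub>c * x\<^sub>a = x\<^sub>-\<^sub>b\<close>.\<close>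

definition okubo_triples :: "((int \<times> int) \<times> (int \<times> int) \<times> (int \<times> int)) set"
  where "okubo_triples =
    {((1, 0), (0, -1), (-1, 1)),
     ((1, 0), (-1, -1), (0, 1)),
     ((1, 0), (1, -1), (1, 1)),
     ((-1, 0), (0, 1), (1, -1)),
     ((-1, 0), (1, 1), (0, -1)),
     ((-1, 0), (-1, 1), (-1, -1)),
     ((0, 1), (1, 1), (-1, 1)),
     ((0, -1), (-1, -1), (1, -1))}"

definition okubo_rotated_triples :: "((int \<times> int) \<times> (int \<times> int) \<times> (int \<times> int)) set"
  where "okubo_rotated_triples = {(a, b, c).
    (a, b, c) \<in> okubo_triples \<or> (b, c, a) \<in> okubo_triples \<or> (c, a, b) \<in> okubo_triples}"

definition okubo_related :: "okubo_index \<Rightarrow> okubo_index \<Rightarrow> okubo_index \<Rightarrow> bool"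
  where "okubo_related u v w \<longleftrightarrow>
    (Rep_okubo_index u, Rep_okubo_index v, Rep_okubo_index w) \<in> okubo_rotated_triples"

text \<open>The sum below has at most one term, see \<open>okubo_mult_triple\<close>.\<close>

definition okubo_basis_mult :: "okubo_index \<Rightarrow> okubo_index \<Rightarrow> 'k::field ^ okubo_index"
  where "okubo_basis_mult u v =
    (if u = v then - axis (okubo_bar u) 1
     else (\<Sum>w | okubo_related u v w. axis (okubo_bar w) 1))"

definition okubo_mult ::
    "'k::field ^ okubo_index \<Rightarrow> 'k ^ okubo_index \<Rightarrow> 'k ^ okubo_index"
  where "okubo_mult x y =
    (\<Sum>u\<in>UNIV. \<Sum>v\<in>UNIV. (vec_nth x u * vec_nth y v) *s okubo_basis_mult u v)"

lemma okubo_mult_axis: "okubo_mult (axis u 1) (axis v 1) = okubo_basis_mult u v"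
proof -
  have "okubo_mult (axis u 1) (axis v 1) =
      (\<Sum>a\<in>UNIV. \<Sum>b\<in>UNIV. if b = v then (if a = u then okubo_basis_mult u v else 0) else 0)"
    unfolding okubo_mult_def by (intro sum.cong refl) (auto simp: axis_def)
  also have "\<dots> = okubo_basis_mult u v" by simp
  finally show ?thesis .
qed

lemma okubo_mult_self: "okubo_mult (axis u 1) (axis u 1) = - axis (okubo_bar u) 1"
  by (simp add: okubo_mult_axis okubo_basis_mult_def)

lemma okubo_triples_props:
  "(a, b, c) \<in> okubo_triples \<Longrightarrow> a \<noteq> b \<and> b \<noteq> c \<and> c \<noteq> a \<and>
    3 dvd fst a + fst b + fst c \<and> 3 dvd snd a + snd b + snd c"
  unfolding okubo_triples_def insert_iff empty_iff prod.inject
  by (elim disjE conjE; simp)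

lemma okubo_rotated_triples_props:
  assumes "(a, b, c) \<in> okubo_rotated_triples"
  shows "a \<noteq> b" "3 dvd fst a + fst b + fst c" "3 dvd snd a + snd b + snd c"
proof -
  consider "(a, b, c) \<in> okubo_triples" | "(b, c, a) \<in> okubo_triples" | "(c, a, b) \<in> okubo_triples"
    using assms by (auto simp: okubo_rotated_triples_def)
  then have "a \<noteq> b \<and> 3 dvd fst a + fst b + fst c \<and> 3 dvd snd a + snd b + snd c"
    by cases (drule okubo_triples_props; simp add: ac_simps)+
  then show "a \<noteq> b" "3 dvd fst a + fst b + fst c" "3 dvd snd a + snd b + snd c" by auto
qed

lemma okubo_related_unique:
  assumes "okubo_related u v w"
  shows "u \<noteq> v" and "okubo_related u v w' \<Longrightarrow> w' = w"
proof -
  show "u \<noteq> v"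
    using okubo_rotated_triples_props(1)[OF assms[unfolded okubo_related_def]] by blast
  have mod3: "c' = c"
    if "3 dvd a + b + c" "3 dvd a + b + c'" "c \<in> {-1, 0, 1}" "c' \<in> {-1, 0, 1}"
    for a b c c' :: int
  proof -
    have "3 dvd c - c'" using dvd_diff[OF that(1,2)] by simp
    moreover have "-1 \<le> c" "c \<le> 1" "-1 \<le> c'" "c' \<le> 1" using that(3,4) by auto
    ultimately show ?thesis by presburger
  qed
  have rng: "fst (Rep_okubo_index i) \<in> {-1, 0, 1}" "snd (Rep_okubo_index i) \<in> {-1, 0, 1}" for i
    using Rep_okubo_index[of i] by (simp_all only: Diff_iff mem_Times_iff)
  assume w': "okubo_related u v w'"
  note props = okubo_rotated_triples_props[OF assms[unfolded okubo_related_def]]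
    and props' = okubo_rotated_triples_props[OF w'[unfolded okubo_related_def]]
  have "Rep_okubo_index w' = Rep_okubo_index w"
    by (rule prod_eqI[OF mod3[OF props(2) props'(2) rng(1) rng(1)]
        mod3[OF props(3) props'(3) rng(2) rng(2)]])
  then show "w' = w" by (simp only: Rep_okubo_index_inject)
qed

lemma okubo_mult_triple:
  assumes "okubo_related u v w"
  shows "okubo_mult (axis u 1) (axis v 1) = axis (okubo_bar w) 1"
proof -
  have "{w'. okubo_related u v w'} = {w}"
    using assms okubo_related_unique(2)[OF assms] by blast
  then show ?thesis
    using okubo_related_unique(1)[OF assms]
    by (simp add: okubo_mult_axis okubo_basis_mult_def)
qed

text \<open>\<open>\<phi>\<close> is an isomorphism of algebras over the algebraic closure.\<close>

locale okubo_algebra = nonassoc_algebra scale mult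
  for scale :: "'f::field \<Rightarrow> 'v::ab_group_add \<Rightarrow> 'v" and mult :: "'v \<Rightarrow> 'v \<Rightarrow> 'v" +
  assumes ext_iso_split_okubo:
    "\<exists>\<phi> :: ('v \<Rightarrow>\<^sub>0 'f alg_closure) set \<Rightarrow> 'f alg_closure ^ okubo_index.
      bij_betw \<phi> ext_carrier UNIV \<and>
      (\<forall>A\<in>ext_carrier. \<forall>B\<in>ext_carrier. \<phi> (ext_add A B) = \<phi> A + \<phi> B) \<and>
      (\<forall>c. \<forall>A\<in>ext_carrier. \<phi> (ext_scale c A) = c *s \<phi> A) \<and>
      (\<forall>A\<in>ext_carrier. \<forall>B\<in>ext_carrier. \<phi> (ext_mult A B) = okubo_mult (\<phi> A) (\<phi> B))"

end

theory Submission
  imports Defs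
begin

text \<open>The norm of the split Okubo algebra satisfies \<open>(x y) x = x (y x) = n(x) y\<close> and descends to the
  ground field, where the absence of zero divisors makes it anisotropic. If \<open>n(x, x x) = 0\<close> and
  \<open>x \<noteq> 0\<close>, then \<open>- x x / n(x)\<close> is an idempotent; hence \<open>n(x, x x) \<noteq> 0\<close> for all \<open>x \<noteq> 0\<close>, and
  \<open>a \<noteq> 0\<close> generates the plane spanned by \<open>a\<close> and \<open>a a\<close>. Modulo this plane, left multiplication by
  \<open>a\<close> satisfies \<open>X\<^sup>6 + n(a, a a) X\<^sup>3 + n(a)\<^sup>3\<close>, which has no proper factor: a factor would give an
  isotropic vector or an idempotent. So for \<open>b\<close> outside the plane the six words of length at most 2
  in \<open>a\<close> and \<open>b\<close> are independent. If the words of length at most 3 did not span, a vector \<open>z\<close>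
  orthogonal to them would give the three independent vectors \<open>z\<close>, \<open>a z\<close>, \<open>z a\<close> in the
  2-dimensional orthogonal complement of the words of length at most 2.\<close>

section \<open>Anisotropic symmetric composition algebras\<close>

context nonassoc_algebra
begin

lemma mult_zero_left [simp]: "0 \<star> x = 0"
  using mult_scale_left[of 0 0 x] by simp

lemma mult_zero_right [simp]: "x \<star> 0 = 0"
  using mult_scale_right[of x 0 0] by simp

lemma mult_minus_left: "(- x) \<star> y = - (x \<star> y)"
  using mult_add_left[of x "- x" y] by (simp add: eq_neg_iff_add_eq_0 add.commute)

lemma mult_minus_right: "x \<star> (- y) = - (x \<star> y)"
  using mult_add_right[of x y "- y"] by (simp add: eq_neg_iff_add_eq_0 add.commute)

lemma mult_diff_left: "(x - y) \<star> z = x \<star> z - y \<star> z"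
  using mult_add_left[of x "- y" z] by (simp add: mult_minus_left)

lemma mult_diff_right: "x \<star> (y - z) = x \<star> y - x \<star> z"
  using mult_add_right[of x y "- z"] by (simp add: mult_minus_right)

lemmas mult_linear = mult_add_left mult_add_right mult_diff_left mult_diff_right
  mult_minus_left mult_minus_right mult_scale_left mult_scale_right

end

text \<open>\<open>q\<close> enters as a bare function: the sandwich identities make it a quadratic
  form with associative polar form, and the absence of zero divisors makes it anisotropic.\<close>

locale anisotropic_symmetric_composition = nonassoc_algebra scale mult
  for scale :: "'f::field \<Rightarrow> 'v::ab_group_add \<Rightarrow> 'v" (infixr \<open>*\<^sub>S\<close> 75)
    and mult :: "'v \<Rightarrow> 'v \<Rightarrow> 'v" (infixl \<open>\<star>\<close> 70) +
  fixes q :: "'v \<Rightarrow> 'f"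
  assumes sandwich_left: "(x \<star> y) \<star> x = q x *\<^sub>S y"
    and sandwich_right: "x \<star> (y \<star> x) = q x *\<^sub>S y"
    and no_idempotent: "c \<star> c = c \<Longrightarrow> c = 0"
    and no_zero_divisor: "x \<star> y = 0 \<Longrightarrow> x = 0 \<or> y = 0"
    and nontrivial: "\<exists>x::'v. x \<noteq> 0"
begin

section \<open>The norm and its polar form\<close>

definition polar :: "'v \<Rightarrow> 'v \<Rightarrow> 'f"
  where "polar x y = q (x + y) - q x - q y"

lemma polar_commute: "polar x y = polar y x"
  by (simp add: polar_def add.commute)

text \<open>Linearization of \<open>sandwich_left\<close>: replace \<open>x\<close> by
  \<open>x + z\<close> and subtract the two pure terms.\<close>

lemma polar_left: "(x \<star> y) \<star> z + (z \<star> y) \<star> x = polar x z *\<^sub>S y"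
proof -
  have "(x \<star> y) \<star> z + (z \<star> y) \<star> x = ((x + z) \<star> y) \<star> (x + z) - (x \<star> y) \<star> x - (z \<star> y) \<star> z"
    by (simp add: mult_linear)
  also have "\<dots> = polar x z *\<^sub>S y"
    by (simp only: sandwich_left polar_def scale_left_diff_distrib)
  finally show ?thesis .
qed

lemma polar_right: "x \<star> (y \<star> z) + z \<star> (y \<star> x) = polar x z *\<^sub>S y"
proof -
  have "x \<star> (y \<star> z) + z \<star> (y \<star> x) = (x + z) \<star> (y \<star> (x + z)) - x \<star> (y \<star> x) - z \<star> (y \<star> z)"
    by (simp add: mult_linear)
  also have "\<dots> = polar x z *\<^sub>S y"
    by (simp only: sandwich_right polar_def scale_left_diff_distrib)
  finally show ?thesis .
qed

text \<open>Scalars are compared through their action on a nonzero vector \<open>w\<close>: by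
  \<open>polar_left\<close>, \<open>polar x z\<close> is the factor of \<open>w\<close> in an
  expression additive in \<open>x\<close>.\<close>

lemma polar_add_left: "polar (x + y) z = polar x z + polar y z"
proof -
  obtain w :: 'v where w: "w \<noteq> 0" using nontrivial by blast
  have "polar (x + y) z *\<^sub>S w = polar x z *\<^sub>S w + polar y z *\<^sub>S w"
    unfolding polar_left[symmetric] by (simp add: mult_linear)
  then show ?thesis using w by (simp flip: scale_left_distrib)
qed

lemma polar_scale_left: "polar (r *\<^sub>S x) z = r * polar x z"
proof -
  obtain w :: 'v where w: "w \<noteq> 0" using nontrivial by blast
  have "polar (r *\<^sub>S x) z *\<^sub>S w = r *\<^sub>S (polar x z *\<^sub>S w)"
    unfolding polar_left[symmetric] by (simp add: mult_linear scale_right_distrib)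
  then show ?thesis using w by simp
qed

lemma polar_add_right: "polar z (x + y) = polar z x + polar z y"
  by (metis polar_add_left polar_commute)

lemma polar_scale_right: "polar z (r *\<^sub>S x) = r * polar z x"
  by (metis polar_scale_left polar_commute)

lemma polar_zero_left [simp]: "polar 0 z = 0"
  using polar_scale_left[of 0 0 z] by simp

text \<open>Associativity of the polar form. Both sides, times \<open>x\<close>, equal \<open>y
  \<star> (x \<star> (z \<star> x)) + (z \<star> x) \<star> (x \<star> y)\<close>, because
  \<open>(x \<star> y) \<star> x\<close> and \<open>x \<star> (z \<star> x)\<close> carry the same
  factor \<open>q x\<close>.\<close>

lemma polar_cyclic: "polar (x \<star> y) z = polar (z \<star> x) y"
proof (cases "x = 0")
  case True
  then show ?thesis by simp
next
  case False
  have "polar (x \<star> y) z *\<^sub>S x = ((x \<star> y) \<star> x) \<star> z + (z \<star> x) \<star> (x \<star> y)"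
    by (simp add: polar_left)
  also have "\<dots> = y \<star> (x \<star> (z \<star> x)) + (z \<star> x) \<star> (x \<star> y)"
    by (simp add: sandwich_left sandwich_right mult_linear)
  also have "\<dots> = polar (z \<star> x) y *\<^sub>S x"
    using polar_right[of "z \<star> x" x y] by (simp add: add.commute)
  finally show ?thesis using False by simp
qed

lemma q_eq_0_iff: "q x = 0 \<longleftrightarrow> x = 0"
proof
  assume "q x = 0"
  then have "(x \<star> x) \<star> x = 0" by (simp add: sandwich_left)
  then show "x = 0" using no_zero_divisor by blast
next
  obtain w :: 'v where w: "w \<noteq> 0" using nontrivial by blast
  assume "x = 0"
  then have "q x *\<^sub>S w = 0" by (simp flip: sandwich_left)
  then show "q x = 0" using w by simp
qed

lemma q_scale: "q (r *\<^sub>S x) = r\<^sup>2 * q x"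
proof -
  obtain w :: 'v where w: "w \<noteq> 0" using nontrivial by blast
  have "q (r *\<^sub>S x) *\<^sub>S w = (r\<^sup>2 * q x) *\<^sub>S w"
    unfolding sandwich_left[symmetric]
    by (simp add: mult_linear power2_eq_square) (simp add: sandwich_left)
  then show ?thesis using w by simp
qed

lemma q_square: "q (x \<star> x) = (q x)\<^sup>2"
proof (cases "x = 0")
  case True
  then show ?thesis by (simp add: q_eq_0_iff[THEN iffD2])
next
  case False
  have "q (x \<star> x) *\<^sub>S x = ((x \<star> x) \<star> x) \<star> (x \<star> x)"
    by (rule sandwich_left[symmetric])
  also have "\<dots> = (q x)\<^sup>2 *\<^sub>S x"
    by (simp add: sandwich_left sandwich_right mult_linear power2_eq_square)
  finally show ?thesis using False by simp
qed

definition cubic :: "'v \<Rightarrow> 'f"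
  where "cubic x = polar x (x \<star> x)"

lemma square_square: "(x \<star> x) \<star> (x \<star> x) = cubic x *\<^sub>S x - q x *\<^sub>S (x \<star> x)"
  using polar_left[of x x "x \<star> x"] by (simp add: sandwich_left mult_linear cubic_def eq_diff_eq)

lemma cubic_nonzero:
  assumes "x \<noteq> 0"
  shows "cubic x \<noteq> 0"
proof
  assume "cubic x = 0"
  define e where "e = (- 1 / q x) *\<^sub>S (x \<star> x)"
  have q: "q x \<noteq> 0" using assms by (simp add: q_eq_0_iff)
  have "e \<star> e = e"
    using q \<open>cubic x = 0\<close> by (simp add: e_def mult_linear square_square)
  then have "e = 0" by (rule no_idempotent)
  then have "x \<star> x = 0" using q by (simp add: e_def)
  then show False using assms no_zero_divisor by blast
qed

section \<open>The subalgebra generated by one element\<close>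

definition plane :: "'v \<Rightarrow> 'v set"
  where "plane a = span {a, a \<star> a}"

lemma in_plane_iff: "x \<in> plane a \<longleftrightarrow> (\<exists>r s. x = r *\<^sub>S a + s *\<^sub>S (a \<star> a))"
proof -
  have "x \<in> plane a \<longleftrightarrow> (\<exists>r s. x - r *\<^sub>S a = s *\<^sub>S (a \<star> a))"
    unfolding plane_def span_insert[of a] span_singleton by auto
  then show ?thesis by (simp add: diff_eq_eq add.commute)
qed

lemma subspace_plane: "subspace (plane a)"
  by (simp add: plane_def)

lemmas plane_add = subspace_add[OF subspace_plane]
  and plane_diff = subspace_diff[OF subspace_plane]
  and plane_scale = subspace_scale[OF subspace_plane]

lemma plane_base: "a \<in> plane a" "a \<star> a \<in> plane a"
  by (simp_all add: plane_def span_base)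

lemma plane_scale_cancel: "r *\<^sub>S x \<in> plane a \<Longrightarrow> r \<noteq> 0 \<Longrightarrow> x \<in> plane a"
  using plane_scale[of "r *\<^sub>S x" a "inverse r"] by simp

lemma plane_mult:
  assumes "x \<in> plane a" "y \<in> plane a"
  shows "x \<star> y \<in> plane a"
proof -
  obtain r s t u where "x = r *\<^sub>S a + s *\<^sub>S (a \<star> a)" "y = t *\<^sub>S a + u *\<^sub>S (a \<star> a)"
    using assms unfolding in_plane_iff by blast
  then show ?thesis
    by (simp add: mult_linear sandwich_left sandwich_right square_square
        plane_add plane_scale plane_diff plane_base)
qed

text \<open>If \<open>a \<star> a = k *\<^sub>S a\<close>, then \<open>k\<close> is nonzero for lack
  of zero divisors, and \<open>a\<close> divided by \<open>k\<close> is an idempotent.\<close>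

lemma plane_independent:
  assumes "a \<noteq> 0" "r *\<^sub>S a + s *\<^sub>S (a \<star> a) = 0"
  shows "r = 0" "s = 0"
proof -
  show "s = 0"
  proof (rule ccontr)
    assume s: "s \<noteq> 0"
    define k where "k = - r / s"
    have "s *\<^sub>S (a \<star> a) = (- r) *\<^sub>S a" using assms(2) by (simp add: eq_neg_iff_add_eq_0 add.commute)
    then have "(1 / s) *\<^sub>S (s *\<^sub>S (a \<star> a)) = (1 / s) *\<^sub>S ((- r) *\<^sub>S a)" by simp
    then have aa: "a \<star> a = k *\<^sub>S a" using s by (simp add: k_def)
    have k: "k \<noteq> 0" using aa no_zero_divisor[of a a] assms(1) by auto
    have "((1 / k) *\<^sub>S a) \<star> ((1 / k) *\<^sub>S a) = (1 / k) *\<^sub>S a"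
      using k by (simp add: mult_linear aa)
    then have "(1 / k) *\<^sub>S a = 0" by (rule no_idempotent)
    then show False using k assms(1) by simp
  qed
  then show "r = 0" using assms by simp
qed

text \<open>The polynomial here is, up to the substitution \<open>X\<^sup>3\<close>, the one that annihilates left
  multiplication by \<open>a\<close> modulo \<open>plane a\<close>; a root gives an isotropic vector.\<close>

lemma no_root:
  assumes "a \<noteq> 0"
  shows "k\<^sup>2 + cubic a * k + (q a)^3 \<noteq> 0"
proof
  assume k: "k\<^sup>2 + cubic a * k + (q a)^3 = 0"
  define x where "x = k *\<^sub>S a + q a *\<^sub>S (a \<star> a)"
  have "q x = q (k *\<^sub>S a) + q (q a *\<^sub>S (a \<star> a)) + polar (k *\<^sub>S a) (q a *\<^sub>S (a \<star> a))"
    by (simp add: x_def polar_def)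
  also have "\<dots> = q a * (k\<^sup>2 + cubic a * k + (q a)^3)"
    by (simp add: q_scale q_square polar_scale_left polar_scale_right flip: cubic_def)
      (simp add: algebra_simps power2_eq_square power3_eq_cube power4_eq_xxxx)
  finally have "x = 0" using k by (simp add: q_eq_0_iff)
  then have "q a = 0" using plane_independent(2)[OF assms] by (simp add: x_def)
  then show False using assms by (simp add: q_eq_0_iff)
qed

text \<open>A quadratic factor \<open>X\<^sup>2 + b X + c\<close> of \<open>X\<^sup>6 + cubic a X\<^sup>3 + (q a)\<^sup>3\<close> would force these
  relations. The cube root of unity \<open>c / q a\<close> reduces them to the case \<open>c = q a\<close>, where \<open>b\<close> is the
  trace of \<open>a\<close> in the quadratic algebra of which the plane is the para-Hurwitz algebra; the
  idempotent is its para-unit.\<close>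

lemma no_quadratic_factor:
  assumes a: "a \<noteq> 0" and g: "cubic a = b^3 - 3 * b * c" and c: "c^3 = (q a)^3" and bc: "b\<^sup>2 \<noteq> c"
  shows False
proof -
  define n w where "n = q a" and "w = c / q a"
  have n0: "n \<noteq> 0" using a by (simp add: n_def q_eq_0_iff)
  have cw: "c = w * n" and w3: "w^3 = 1"
    using n0 c by (simp_all add: w_def n_def power_divide)
  define t where "t = b * w"
  have g': "cubic a = t^3 - 3 * t * n"
    unfolding g t_def cw using w3 by (simp add: power_mult_distrib)
  have "t\<^sup>2 - n = w\<^sup>2 * (b\<^sup>2 - c)"
    using w3 by (simp add: t_def cw power2_eq_square power3_eq_cube algebra_simps)
  moreover have "w \<noteq> 0" using w3 by auto
  ultimately have tn: "t\<^sup>2 - n \<noteq> 0" using bc by simp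
  define e where "e = t *\<^sub>S a + a \<star> a"
  have "e \<star> e = (cubic a + 2 * t * n) *\<^sub>S a + (t\<^sup>2 - n) *\<^sub>S (a \<star> a)"
    unfolding e_def
    by (simp add: mult_linear sandwich_left sandwich_right square_square algebra_simps
        power2_eq_square flip: n_def)
      (simp flip: scale_left_distrib add: algebra_simps)
  also have "cubic a + 2 * t * n = (t\<^sup>2 - n) * t"
    unfolding g' by (simp add: algebra_simps power2_eq_square power3_eq_cube)
  finally have ee: "e \<star> e = (t\<^sup>2 - n) *\<^sub>S e"
    by (simp add: e_def scale_right_distrib)
  have "((1 / (t\<^sup>2 - n)) *\<^sub>S e) \<star> ((1 / (t\<^sup>2 - n)) *\<^sub>S e) = (1 / (t\<^sup>2 - n)) *\<^sub>S e"
    using tn by (simp add: mult_linear ee)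
  then have "(1 / (t\<^sup>2 - n)) *\<^sub>S e = 0" by (rule no_idempotent)
  then have "e = 0" using tn by simp
  then show False using plane_independent(2)[OF a, of t 1] by (simp add: e_def)
qed

text \<open>The square of \<open>a \<star> a\<close>, acting on \<open>x\<close>, is expanded once
  by \<open>square_square\<close> and once by \<open>polar_left\<close>. Comparing the two puts
  \<open>h\<close> in the plane, and two more multiplications by \<open>a\<close> leave only powers
  of left multiplication.\<close>

lemma left_mult_annihilator:
  "a \<star> (a \<star> (a \<star> (a \<star> (a \<star> (a \<star> x))))) + cubic a *\<^sub>S (a \<star> (a \<star> (a \<star> x))) + (q a)^3 *\<^sub>S x \<in> plane a"
proof -
  define d where "d = a \<star> a"
  \<comment> \<open>Modulo multiples of \<open>a\<close>, right multiplication by \<open>d\<close>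
    is minus the square of left multiplication by \<open>a\<close>, and left multiplication by
    \<open>d\<close> is minus the square of right multiplication by \<open>a\<close>.\<close>
  have xd: "y \<star> d = polar y a *\<^sub>S a - a \<star> (a \<star> y)" for y
    using polar_right[of y a a] by (simp add: d_def eq_diff_eq)
  have dx: "d \<star> x = polar a x *\<^sub>S a - (x \<star> a) \<star> a"
    using polar_left[of a a x] by (simp add: d_def eq_diff_eq)
  have ddx: "(d \<star> d) \<star> x = polar d x *\<^sub>S d - (x \<star> d) \<star> d"
    using polar_left[of d d x] by (simp add: eq_diff_eq)
  define h where "h = cubic a *\<^sub>S (a \<star> x) - q a *\<^sub>S (d \<star> x) + a \<star> (a \<star> (a \<star> (a \<star> x)))"
  have "h = polar d x *\<^sub>S d - polar x a *\<^sub>S (a \<star> d) + polar (a \<star> (a \<star> x)) a *\<^sub>S a"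
  proof -
    have "(x \<star> d) \<star> d = polar x a *\<^sub>S (a \<star> d) -
        (polar (a \<star> (a \<star> x)) a *\<^sub>S a - a \<star> (a \<star> (a \<star> (a \<star> x))))"
      by (simp only: xd[of x] mult_linear xd[of "a \<star> (a \<star> x)"])
    moreover have "(d \<star> d) \<star> x = cubic a *\<^sub>S (a \<star> x) - q a *\<^sub>S (d \<star> x)"
      by (simp add: square_square[of a, folded d_def] mult_linear)
    ultimately have "cubic a *\<^sub>S (a \<star> x) - q a *\<^sub>S (d \<star> x) = polar d x *\<^sub>S d -
        (polar x a *\<^sub>S (a \<star> d) - (polar (a \<star> (a \<star> x)) a *\<^sub>S a - a \<star> (a \<star> (a \<star> (a \<star> x)))))"
      using ddx by (simp only:)
    then show ?thesis by (simp add: h_def)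
  qed
  then have "h \<in> plane a"
    by (simp add: d_def plane_add plane_diff plane_scale plane_mult plane_base)
  \<comment> \<open>Left and right multiplication by \<open>a\<close> compose to the scalar
    \<open>q a\<close>, so \<open>(x \<star> a) \<star> a\<close> becomes
    \<open>(q a)\<^sup>2 *\<^sub>S x\<close>; the added multiple of \<open>a\<close> cancels the
    polar term.\<close>
  then have "a \<star> (a \<star> h) + (q a * polar a x * q a) *\<^sub>S a \<in> plane a"
    by (simp add: plane_add plane_scale plane_mult plane_base)
  also have "a \<star> (a \<star> h) + (q a * polar a x * q a) *\<^sub>S a =
      a \<star> (a \<star> (a \<star> (a \<star> (a \<star> (a \<star> x))))) + cubic a *\<^sub>S (a \<star> (a \<star> (a \<star> x))) + (q a)^3 *\<^sub>S x"
    by (simp add: h_def dx mult_linear sandwich_right algebra_simps power3_eq_cube)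
  finally show ?thesis .
qed

text \<open>A relation with \<open>r1\<close> nonzero makes \<open>x\<close> an eigenvector of left
  multiplication by \<open>a\<close> modulo the plane, and the cube of the eigenvalue is a root
  excluded by \<open>no_root\<close>.\<close>

lemma left_mult_independent_1:
  assumes a: "a \<noteq> 0" and x: "x \<notin> plane a" and m: "r0 *\<^sub>S x + r1 *\<^sub>S (a \<star> x) \<in> plane a"
  shows "r0 = 0" "r1 = 0"
proof -
  show "r1 = 0"
  proof (rule ccontr)
    assume r1: "r1 \<noteq> 0"
    define k where "k = - r0 / r1"
    have "(1 / r1) *\<^sub>S (r0 *\<^sub>S x + r1 *\<^sub>S (a \<star> x)) = a \<star> x - k *\<^sub>S x"
      using r1 by (simp add: k_def scale_right_distrib)
    then have k1: "a \<star> x - k *\<^sub>S x \<in> plane a" using plane_scale[OF m, of "1 / r1"] by simp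
    have step: "a \<star> y - (k * s) *\<^sub>S x \<in> plane a" if "y - s *\<^sub>S x \<in> plane a" for y s
    proof -
      have "a \<star> y - (k * s) *\<^sub>S x = a \<star> (y - s *\<^sub>S x) + s *\<^sub>S (a \<star> x - k *\<^sub>S x)"
        by (simp add: mult_linear algebra_simps)
      then show ?thesis using k1 that by (simp add: plane_add plane_scale plane_mult plane_base)
    qed
    have k3: "a \<star> (a \<star> (a \<star> x)) - (k * (k * k)) *\<^sub>S x \<in> plane a"
      by (rule step[OF step[OF k1]])
    have k6: "a \<star> (a \<star> (a \<star> (a \<star> (a \<star> (a \<star> x))))) - (k * (k * (k * (k * (k * k))))) *\<^sub>S x \<in> plane a"
      by (rule step[OF step[OF step[OF k3]]])
    have "((k^3)\<^sup>2 + cubic a * k^3 + (q a)^3) *\<^sub>S x =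
      (a \<star> (a \<star> (a \<star> (a \<star> (a \<star> (a \<star> x))))) + cubic a *\<^sub>S (a \<star> (a \<star> (a \<star> x))) + (q a)^3 *\<^sub>S x)
      - (a \<star> (a \<star> (a \<star> (a \<star> (a \<star> (a \<star> x))))) - (k * (k * (k * (k * (k * k))))) *\<^sub>S x)
      - cubic a *\<^sub>S (a \<star> (a \<star> (a \<star> x)) - (k * (k * k)) *\<^sub>S x)"
      by (simp add: algebra_simps power2_eq_square power3_eq_cube)
    also have "\<dots> \<in> plane a"
      by (rule plane_diff[OF plane_diff[OF left_mult_annihilator k6] plane_scale[OF k3]])
    finally show False using plane_scale_cancel no_root[OF a] x by blast
  qed
  then show "r0 = 0" using m plane_scale_cancel x by auto
qed

text \<open>A relation with \<open>r2\<close> nonzero is a monic quadratic killing \<open>x\<close>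
  modulo the plane. Dividing the annihilating polynomial by it leaves a linear remainder, whose
  coefficients vanish by the degree 1 case; then \<open>no_quadratic_factor\<close> applies.\<close>

lemma left_mult_independent_2:
  assumes a: "a \<noteq> 0" and x: "x \<notin> plane a"
    and m: "r0 *\<^sub>S x + r1 *\<^sub>S (a \<star> x) + r2 *\<^sub>S (a \<star> (a \<star> x)) \<in> plane a"
  shows "r0 = 0" "r1 = 0" "r2 = 0"
proof -
  show r2: "r2 = 0"
  proof (rule ccontr)
    assume r2: "r2 \<noteq> 0"
    define b c where "b = r1 / r2" and "c = r0 / r2"
    define m2 where "m2 = a \<star> (a \<star> x) + b *\<^sub>S (a \<star> x) + c *\<^sub>S x"
    have "m2 = (1 / r2) *\<^sub>S (r0 *\<^sub>S x + r1 *\<^sub>S (a \<star> x) + r2 *\<^sub>S (a \<star> (a \<star> x)))"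
      using r2 by (simp add: m2_def b_def c_def scale_right_distrib)
    then have m2: "m2 \<in> plane a" using plane_scale[OF m] by simp
    \<comment> \<open>Modulo \<open>X\<^sup>2 + b X + c\<close> one has
      \<open>X\<^sup>3 = s X + t\<close>; \<open>y\<close> is the difference applied to
      \<open>x\<close>.\<close>
    define s t y where "s = b\<^sup>2 - c" and "t = b * c"
      and "y = a \<star> (a \<star> (a \<star> x)) - s *\<^sub>S (a \<star> x) - t *\<^sub>S x"
    have "y = a \<star> m2 - b *\<^sub>S m2"
      by (simp add: y_def m2_def s_def t_def mult_linear algebra_simps power2_eq_square)
    then have y: "y \<in> plane a" using m2 by (simp add: plane_diff plane_scale plane_mult plane_base)
    have "(t * t + cubic a * t + (q a)^3 - s * s * c) *\<^sub>S x +
        ((s * t) *\<^sub>S (a \<star> x) + (s * (t + cubic a - s * b)) *\<^sub>S (a \<star> x)) =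
      (a \<star> (a \<star> (a \<star> (a \<star> (a \<star> (a \<star> x))))) + cubic a *\<^sub>S (a \<star> (a \<star> (a \<star> x))) + (q a)^3 *\<^sub>S x)
      - a \<star> (a \<star> (a \<star> y)) - s *\<^sub>S (a \<star> y) - (t + cubic a) *\<^sub>S y - (s * s) *\<^sub>S m2"
      unfolding y_def m2_def by (simp add: mult_linear algebra_simps)
    also have "\<dots> \<in> plane a"
      using left_mult_annihilator y m2 by (intro plane_diff plane_scale plane_mult plane_base)
    finally have r: "t * t + cubic a * t + (q a)^3 - s * s * c = 0"
        "s * t + s * (t + cubic a - s * b) = 0"
      using left_mult_independent_1[OF a x] unfolding scale_left_distrib[symmetric] by blast+
    \<comment> \<open>With \<open>s = 0\<close> the constant coefficient would make \<open>t\<close>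
      a root. So \<open>s\<close> can be cancelled from the linear coefficient.\<close>
    have "s \<noteq> 0" using r(1) no_root[OF a, of t] by (auto simp: power2_eq_square)
    then have g: "cubic a = b^3 - 3 * b * c"
    proof -
      have "s * (2 * t + cubic a - s * b) = 0" using r(2) by (simp add: algebra_simps)
      then have "2 * t + cubic a - s * b = 0" using \<open>s \<noteq> 0\<close> by simp
      then have "cubic a = s * b - 2 * t" by (simp add: algebra_simps eq_diff_eq)
      also have "\<dots> = b^3 - 3 * b * c"
        by (simp add: s_def t_def algebra_simps power2_eq_square power3_eq_cube)
      finally show ?thesis .
    qed
    have "c^3 = (q a)^3"
      using r(1) unfolding g s_def t_def
      by (simp add: algebra_simps power2_eq_square power3_eq_cube)
    then show False using no_quadratic_factor[OF a g] \<open>s \<noteq> 0\<close> by (simp add: s_def)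
  qed
  show "r0 = 0" "r1 = 0" using left_mult_independent_1[OF a x] m r2 by auto
qed

text \<open>If \<open>X\<^sup>3 + b X\<^sup>2 + c X + d\<close> divides \<open>X\<^sup>6 + g X\<^sup>3 + n\<^sup>3\<close> and \<open>b \<noteq> 0\<close>, then comparing coefficients
  gives \<open>b\<^sup>3 d = c\<^sup>2 (b\<^sup>2 - c)\<close>, so that \<open>(c - b\<^sup>2) / b\<close> is a root.\<close>

lemma left_mult_independent_3:
  assumes a: "a \<noteq> 0" and x: "x \<notin> plane a"
    and m: "r0 *\<^sub>S x + r1 *\<^sub>S (a \<star> x) + r2 *\<^sub>S (a \<star> (a \<star> x)) + r3 *\<^sub>S (a \<star> (a \<star> (a \<star> x))) \<in> plane a"
  shows "r0 = 0" "r1 = 0" "r2 = 0" "r3 = 0"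
proof -
  show r3: "r3 = 0"
  proof (rule ccontr)
    assume r3: "r3 \<noteq> 0"
    define b c d where "b = r2 / r3" and "c = r1 / r3" and "d = r0 / r3"
    define g n3 where "g = cubic a" and "n3 = (q a)^3"
    define m3 where "m3 = a \<star> (a \<star> (a \<star> x)) + b *\<^sub>S (a \<star> (a \<star> x)) + c *\<^sub>S (a \<star> x) + d *\<^sub>S x"
    have "m3 = (1 / r3) *\<^sub>S (r0 *\<^sub>S x + r1 *\<^sub>S (a \<star> x) + r2 *\<^sub>S (a \<star> (a \<star> x)) + r3 *\<^sub>S (a \<star> (a \<star> (a \<star> x))))"
      using r3 by (simp add: m3_def b_def c_def d_def scale_right_distrib)
    then have m3: "m3 \<in> plane a" using plane_scale[OF m] by simp
    define f where
      "f = a \<star> (a \<star> (a \<star> (a \<star> (a \<star> (a \<star> x))))) + g *\<^sub>S (a \<star> (a \<star> (a \<star> x))) + n3 *\<^sub>S x"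
    have f: "f \<in> plane a"
      using left_mult_annihilator by (simp add: f_def g_def n3_def)
    \<comment> \<open>Division by the cubic has quotient
      \<open>X\<^sup>3 - b X\<^sup>2 + s X + (g - u)\<close>; with this \<open>s\<close> and
      \<open>u\<close> no term of degree 3 or 4 remains.\<close>
    define s u where "s = b * b - c" and "u = s * b - b * c + d"
    have "(d * u - g * d + n3) *\<^sub>S x + (c * u - s * d - g * c) *\<^sub>S (a \<star> x) +
        (b * u - s * c + b * d - g * b) *\<^sub>S (a \<star> (a \<star> x)) +
        (u + b * c - d - s * b) *\<^sub>S (a \<star> (a \<star> (a \<star> x))) +
        (b * b - c - s) *\<^sub>S (a \<star> (a \<star> (a \<star> (a \<star> x)))) =
      f - a \<star> (a \<star> (a \<star> m3)) + b *\<^sub>S (a \<star> (a \<star> m3)) - s *\<^sub>S (a \<star> m3) - (g - u) *\<^sub>S m3"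
      unfolding m3_def f_def by (simp add: mult_linear algebra_simps)
    also have "\<dots> \<in> plane a"
      using f m3 by (intro plane_diff plane_add plane_scale plane_mult plane_base)
    also have "u + b * c - d - s * b = 0" by (simp add: u_def)
    also have "b * b - c - s = 0" by (simp add: s_def)
    finally have "(d * u - g * d + n3) *\<^sub>S x + (c * u - s * d - g * c) *\<^sub>S (a \<star> x) +
        (b * u - s * c + b * d - g * b) *\<^sub>S (a \<star> (a \<star> x)) \<in> plane a"
      by simp
    note r = left_mult_independent_2[OF a x this]
    have "\<exists>k. k\<^sup>2 + g * k + n3 = 0"
    \<comment> \<open>For \<open>b = 0\<close> the vanishing remainder forces \<open>c = 0\<close>;
      the factor is \<open>X\<^sup>3 + d\<close>, and \<open>- d\<close> is a root.\<close>
    proof (cases "b = 0")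
      case True
      then have "c = 0" using r(3) by (simp add: s_def)
      then have "(- d)\<^sup>2 + g * (- d) + n3 = 0"
        using r(1) True by (simp add: u_def power2_eq_square)
      then show ?thesis by blast
    next
      case False
      define k where "k = (c - b\<^sup>2) / b"
      have kb: "k * b = c - b\<^sup>2" using False by (simp add: k_def)
      have "b^3 * d = c\<^sup>2 * (b\<^sup>2 - c)"
      proof -
        have "b^3 * d - c\<^sup>2 * (b\<^sup>2 - c) =
            c * (b * u - s * c + b * d - g * b) - b * (c * u - s * d - g * c)"
          by (simp add: s_def algebra_simps power2_eq_square power3_eq_cube)
        then show ?thesis by (simp add: r)
      qed
      then have "b^3 * (k^3 + b * k\<^sup>2 + c * k + d) = 0"
      proof -
        have "b^3 * (k^3 + b * k\<^sup>2 + c * k + d) =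
            (k * b)^3 + b\<^sup>2 * (k * b)\<^sup>2 + b\<^sup>2 * c * (k * b) + b^3 * d"
          by (simp add: algebra_simps power2_eq_square power3_eq_cube)
        also have "\<dots> = 0"
          unfolding kb \<open>b^3 * d = c\<^sup>2 * (b\<^sup>2 - c)\<close>
          by (simp add: algebra_simps power2_eq_square power3_eq_cube)
        finally show ?thesis .
      qed
      then have k: "k^3 + b * k\<^sup>2 + c * k + d = 0" using False by simp
      \<comment> \<open>The division identity evaluated at \<open>k\<close>, where both the
        remainder and the divisor vanish.\<close>
      have "(k^3)\<^sup>2 + g * k^3 + n3 =
          (d * u - g * d + n3) + (c * u - s * d - g * c) * k +
          (b * u - s * c + b * d - g * b) * k\<^sup>2 +
          (k^3 - b * k\<^sup>2 + s * k + g - u) * (k^3 + b * k\<^sup>2 + c * k + d)"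
        by (simp add: s_def u_def algebra_simps power2_eq_square power3_eq_cube)
      then have "(k^3)\<^sup>2 + g * k^3 + n3 = 0"
        by (simp add: k r)
      then show ?thesis by blast
    qed
    then show False using no_root[OF a] by (simp add: g_def n3_def)
  qed
  show "r0 = 0" "r1 = 0" "r2 = 0" using left_mult_independent_2[OF a x] m r3 by auto
qed

text \<open>Left multiplication by \<open>a\<close> preserves the plane and sends the four words,
  modulo it, to \<open>a \<star> b\<close>, \<open>a \<star> (a \<star> b)\<close>,
  \<open>q a *\<^sub>S b\<close> and \<open>- (a \<star> (a \<star> (a \<star> b)))\<close>. This is
  the situation of \<open>left_mult_independent_3\<close>.\<close>

lemma independent_mod_plane:
  assumes a: "a \<noteq> 0" and b: "b \<notin> plane a"
    and m: "r0 *\<^sub>S b + r1 *\<^sub>S (a \<star> b) + r2 *\<^sub>S (b \<star> a) + r3 *\<^sub>S (b \<star> (a \<star> a)) \<in> plane a"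
  shows "r0 = 0" "r1 = 0" "r2 = 0" "r3 = 0"
proof -
  have baa: "b \<star> (a \<star> a) = polar b a *\<^sub>S a - a \<star> (a \<star> b)"
    using polar_right[of b a a] by (simp add: eq_diff_eq)
  have "(r2 * q a) *\<^sub>S b + r0 *\<^sub>S (a \<star> b) + r1 *\<^sub>S (a \<star> (a \<star> b)) + (- r3) *\<^sub>S (a \<star> (a \<star> (a \<star> b)))
    = a \<star> (r0 *\<^sub>S b + r1 *\<^sub>S (a \<star> b) + r2 *\<^sub>S (b \<star> a) + r3 *\<^sub>S (b \<star> (a \<star> a))) - (r3 * polar b a) *\<^sub>S (a \<star> a)"
    by (simp add: baa mult_linear sandwich_right algebra_simps)
  also have "\<dots> \<in> plane a"
    using m by (intro plane_diff plane_scale plane_mult plane_base)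
  finally have "r2 * q a = 0" "r0 = 0" "r1 = 0" "- r3 = 0"
    using left_mult_independent_3[OF a b] by blast+
  then show "r0 = 0" "r1 = 0" "r2 = 0" "r3 = 0" using a by (simp_all add: q_eq_0_iff)
qed

end

section \<open>Words in dimension 8\<close>

context vector_space
begin

text \<open>Induction on the functionals: two independent vectors killed by all but one of them can
  be combined so that the last one vanishes as well.\<close>

lemma exists_common_kernel_vector:
  assumes "finite C" "independent B" "card C < card B"
    and F_add: "\<And>c x y. c \<in> C \<Longrightarrow> F c (x + y) = F c x + F c y"
    and F_scale: "\<And>c r x. c \<in> C \<Longrightarrow> F c (scale r x) = r * F c x"
  shows "\<exists>z\<in>span B. z \<noteq> 0 \<and> (\<forall>c\<in>C. F c z = (0 :: 'a))"
  using assms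
proof (induction C arbitrary: B rule: finite_induct)
  case empty
  then obtain b where "b \<in> B" by fastforce
  then show ?case using empty(1) by (metis dependent_zero span_base empty_iff)
next
  case (insert c C)
  have less: "card C < card (B - {b})" if "b \<in> B" for b
    using insert.prems(2) insert.hyps that by (simp add: card_Diff_singleton)
  have IH: "\<exists>z\<in>span (B - {b}). z \<noteq> 0 \<and> (\<forall>c\<in>C. F c z = 0)" if "b \<in> B" for b
    using insert.prems less[OF that] independent_mono[OF insert.prems(1), of "B - {b}"]
    by (intro insert.IH) auto
  have "B \<noteq> {}" using insert.prems(2) by auto
  then obtain z1 where z1: "z1 \<in> span B" "z1 \<noteq> 0" "\<forall>c\<in>C. F c z1 = 0"
    using IH span_mono[of "B - {_}" B] by blast
  have "\<exists>b. representation B z1 b \<noteq> 0"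
  proof (rule ccontr)
    assume "\<not> ?thesis"
    then have "z1 = 0"
      using sum_nonzero_representation_eq[OF insert.prems(1) z1(1)] by simp
    then show False using z1(2) by blast
  qed
  then obtain b where b: "representation B z1 b \<noteq> 0" ..
  \<comment> \<open>Removing from \<open>B\<close> a vector that occurs in \<open>z1\<close> keeps
    \<open>z1\<close> out of the span in which \<open>z2\<close> is found.\<close>
  have "b \<in> B" by (rule representation_ne_zero[OF b])
  then obtain z2 where z2: "z2 \<in> span (B - {b})" "z2 \<noteq> 0" "\<forall>c\<in>C. F c z2 = 0"
    using IH by blast
  have z1': "z1 \<notin> span (B - {b})"
    using b representation_extend[OF insert.prems(1), of z1 "B - {b}"]
      representation_ne_zero[of "B - {b}" z1 b] by auto
  have z2B: "z2 \<in> span B" using z2(1) span_mono[of "B - {b}" B] by blast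
  show ?case
  proof (cases "F c z2 = 0")
    case True
    then show ?thesis using z2 z2B by blast
  next
    case False
    define k where "k = - F c z1 / F c z2"
    have k: "F c z1 + k * F c z2 = 0" using False by (simp add: k_def)
    define z where "z = z1 + scale k z2"
    have "z \<noteq> 0"
    proof
      assume "z = 0"
      then have "z1 = - scale k z2"
        by (simp add: z_def eq_neg_iff_add_eq_0)
      then show False
        using z1' span_neg[OF span_scale[OF z2(1)]] by metis
    qed
    moreover have "z \<in> span B"
      unfolding z_def by (intro span_add span_scale z1(1) z2B)
    moreover have "\<forall>c'\<in>insert c C. F c' z = 0"
      using k z1(3) z2(3) by (auto simp: z_def insert.prems(3,4))
    ultimately show ?thesis by blast
  qed
qed

end

section \<open>Independence of the words of length at most 2\<close>

context anisotropic_symmetric_composition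
begin

text \<open>\<open>plane c\<close> has dimension at most 2, so the independent vectors
  \<open>a\<close> and \<open>a \<star> a\<close> in it already span it.\<close>

lemma plane_subset:
  assumes a: "a \<noteq> 0" and ac: "a \<in> plane c"
  shows "plane c \<subseteq> plane a"
proof -
  have "a \<notin> span {a \<star> a}"
  proof
    assume "a \<in> span {a \<star> a}"
    then obtain k where "a = k *\<^sub>S (a \<star> a)" unfolding span_singleton by blast
    then have "1 *\<^sub>S a + (- k) *\<^sub>S (a \<star> a) = 0" by simp
    then show False using plane_independent(1)[OF a] by fastforce
  qed
  moreover have "a \<star> a \<noteq> 0" using a no_zero_divisor by blast
  ultimately have ind: "independent {a, a \<star> a}" and "a \<noteq> a \<star> a"
    using independent_insertI[of a "{a \<star> a}"] span_base[of "a \<star> a" "{a \<star> a}"] by auto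
  then have card: "card {a, a \<star> a} = 2" by simp
  show ?thesis
  proof
    fix x assume x: "x \<in> plane c"
    show "x \<in> plane a"
    proof (rule ccontr)
      assume "x \<notin> plane a"
      then have "independent {x, a, a \<star> a}" and "x \<notin> {a, a \<star> a}"
        using independent_insertI[OF _ ind, of x] span_base[of x "{a, a \<star> a}"]
        by (auto simp: plane_def)
      moreover have "{x, a, a \<star> a} \<subseteq> span {c, c \<star> c}"
        using x ac plane_mult[OF ac ac] by (simp add: plane_def)
      ultimately have "card {x, a, a \<star> a} \<le> card {c, c \<star> c}"
        using independent_span_bound[of "{c, c \<star> c}" "{x, a, a \<star> a}"] by simp
      then show False
        using card \<open>x \<notin> {a, a \<star> a}\<close> by (simp add: card_insert_if split: if_splits)
    qed
  qed
qed

text \<open>Multiplying the relation by \<open>b\<close> forces \<open>l = - (s * r)\<close>, and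
  the relation then factors as \<open>c \<star> d = m *\<^sub>S a + v *\<^sub>S b\<close> with
  \<open>c = b - r *\<^sub>S a\<close> and \<open>d = b - s *\<^sub>S a\<close>. Both for
  \<open>r = s\<close> and otherwise this contradicts independence statements based at
  \<open>c\<close>.\<close>

lemma square_notin:
  assumes a: "a \<noteq> 0" and b: "b \<notin> plane a"
  shows "b \<star> b \<noteq> m *\<^sub>S a + l *\<^sub>S (a \<star> a) + v *\<^sub>S b + r *\<^sub>S (a \<star> b) + s *\<^sub>S (b \<star> a)"
proof
  assume bb: "b \<star> b = m *\<^sub>S a + l *\<^sub>S (a \<star> a) + v *\<^sub>S b + r *\<^sub>S (a \<star> b) + s *\<^sub>S (b \<star> a)"
  define N where "N = polar a b"
  have aab: "a \<star> (a \<star> b) = N *\<^sub>S a - b \<star> (a \<star> a)"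
    using polar_right[of a a b] by (simp add: N_def eq_diff_eq)
  have bba: "b \<star> (b \<star> a) = N *\<^sub>S b - a \<star> (b \<star> b)"
    using polar_right[of b b a] by (simp add: N_def eq_diff_eq polar_commute)
  have "q b *\<^sub>S b = b \<star> (m *\<^sub>S a + l *\<^sub>S (a \<star> a) + v *\<^sub>S b + r *\<^sub>S (a \<star> b) + s *\<^sub>S (b \<star> a))"
    by (simp only: sandwich_right flip: bb)
  also have "\<dots> = m *\<^sub>S (b \<star> a) + l *\<^sub>S (b \<star> (a \<star> a)) + v *\<^sub>S (b \<star> b) + (r * q b) *\<^sub>S a + s *\<^sub>S (b \<star> (b \<star> a))"
    by (simp add: mult_linear sandwich_right)
  finally have qb: "q b *\<^sub>S b = \<dots>" .
  \<comment> \<open>The multiplied relation is sorted by the four words of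
    \<open>independent_mod_plane\<close>; the coefficient of \<open>b \<star> (a \<star> a)\<close>
    gives the value of \<open>l\<close>.\<close>
  have "(v * v + s * N - s * s * q a - q b) *\<^sub>S b + (v * r - s * v) *\<^sub>S (a \<star> b) +
      (m + v * s) *\<^sub>S (b \<star> a) + (l + s * r) *\<^sub>S (b \<star> (a \<star> a)) =
    (m *\<^sub>S (b \<star> a) + l *\<^sub>S (b \<star> (a \<star> a)) + v *\<^sub>S (b \<star> b) + (r * q b) *\<^sub>S a + s *\<^sub>S (b \<star> (b \<star> a)))
    - q b *\<^sub>S b + (- (v * m + r * q b - s * l * q a - s * r * N) *\<^sub>S a + (s * m - v * l) *\<^sub>S (a \<star> a))"
    by (simp add: bba bb aab mult_linear sandwich_right algebra_simps)
  also have "\<dots> \<in> plane a"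
    unfolding qb[symmetric] by (simp add: plane_add plane_diff plane_scale plane_base)
  finally have "l + s * r = 0" by (rule independent_mod_plane(4)[OF a b])
  then have l: "l = - (s * r)" by (simp add: eq_neg_iff_add_eq_0)
  define c d where "c = b - r *\<^sub>S a" and "d = b - s *\<^sub>S a"
  have cd: "c \<star> d = m *\<^sub>S a + v *\<^sub>S b"
    by (simp add: c_def d_def mult_linear bb l algebra_simps)
  have nz: "b - k *\<^sub>S a \<noteq> 0" for k
    using b plane_scale[OF plane_base(1)] by auto
  have ac: "a \<notin> plane c"
  proof
    assume "a \<in> plane c"
    then have "c \<in> plane a" using plane_subset[OF a] plane_base(1) by blast
    then have "c + r *\<^sub>S a \<in> plane a" by (simp add: plane_add plane_scale plane_base)
    then show False using b by (simp add: c_def)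
  qed
  show False
  proof (cases "r = s")
    case True
    then have cc: "c \<star> c = (m + v * r) *\<^sub>S a + v *\<^sub>S c"
      using cd by (simp add: c_def d_def algebra_simps)
    then have "(m + v * r) *\<^sub>S a = c \<star> c - v *\<^sub>S c" by simp
    also have "\<dots> \<in> plane c" by (simp add: plane_diff plane_scale plane_base)
    finally have "m + v * r = 0" using ac plane_scale_cancel by blast
    then have "(- v) *\<^sub>S c + 1 *\<^sub>S (c \<star> c) = 0" by (simp add: cc)
    then show False using plane_independent(2)[of c "- v" 1] nz[of r] by (simp add: c_def)
  next
    case False
    \<comment> \<open>As \<open>c - d\<close> is a nonzero multiple of \<open>a\<close>, the product
      \<open>c \<star> d\<close> is a combination of \<open>c\<close> and \<open>d\<close>. Right
      multiplication by \<open>c\<close> yields a relation modulo \<open>plane c\<close> in which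
      \<open>d\<close> has coefficient \<open>q c\<close>.\<close>
    define k where "k = (m + v * r) / (s - r)"
    have ka: "(m + v * r) *\<^sub>S a = k *\<^sub>S (c - d)"
      using False by (simp add: k_def c_def d_def flip: scale_left_diff_distrib)
    have "c \<star> d = v *\<^sub>S c + k *\<^sub>S (c - d)"
      unfolding cd ka[symmetric] by (simp add: c_def algebra_simps)
    then have "q c *\<^sub>S d = (v *\<^sub>S c + k *\<^sub>S (c - d)) \<star> c"
      using sandwich_left[of c d] by simp
    then have "q c *\<^sub>S d + 0 *\<^sub>S (c \<star> d) + k *\<^sub>S (d \<star> c) + 0 *\<^sub>S (d \<star> (c \<star> c)) = (v + k) *\<^sub>S (c \<star> c)"
      by (simp add: mult_linear algebra_simps)
    also have "\<dots> \<in> plane c" by (simp add: plane_scale plane_base)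
    finally have *: "q c *\<^sub>S d + 0 *\<^sub>S (c \<star> d) + k *\<^sub>S (d \<star> c) + 0 *\<^sub>S (d \<star> (c \<star> c)) \<in> plane c" .
    have "d \<notin> plane c"
    proof
      assume "d \<in> plane c"
      then have "c - d \<in> plane c" by (simp add: plane_diff plane_base)
      moreover have "c - d = (s - r) *\<^sub>S a" by (simp add: c_def d_def algebra_simps)
      ultimately show False using ac plane_scale_cancel[of "s - r" a c] False by simp
    qed
    then have "q c = 0" using independent_mod_plane(1)[OF _ _ *] nz[of r] by (simp add: c_def)
    then show False using nz[of r] by (simp add: q_eq_0_iff c_def)
  qed
qed

text \<open>The vectors are adjoined from the last to the first. A dependence would give a relation
  with a coefficient 1, which \<open>plane_independent\<close> or
  \<open>independent_mod_plane\<close> forbids, and for \<open>b \<star> b\<close> it contradicts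
  \<open>square_notin\<close>.\<close>

lemma independent_two_generators:
  assumes a: "a \<noteq> 0" and b: "b \<notin> plane a"
  shows "independent {b \<star> b, b \<star> a, a \<star> b, b, a \<star> a, a}" (is ?ind)
    and "card {b \<star> b, b \<star> a, a \<star> b, b, a \<star> a, a} = 6" (is ?card)
proof -
  have aa: "a \<star> a \<notin> span {a}"
  proof
    assume "a \<star> a \<in> span {a}"
    then obtain k where "a \<star> a = k *\<^sub>S a" unfolding span_singleton by blast
    then have "(- k) *\<^sub>S a + 1 *\<^sub>S (a \<star> a) = 0" by simp
    then show False using plane_independent(2)[OF a] by fastforce
  qed
  have plane_eq: "span {a \<star> a, a} = plane a" by (simp add: plane_def insert_commute)
  have b': "b \<notin> span {a \<star> a, a}" using b by (simp add: plane_eq)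
  have ab: "a \<star> b \<notin> span {b, a \<star> a, a}"
  proof
    assume "a \<star> b \<in> span {b, a \<star> a, a}"
    then obtain k where "a \<star> b - k *\<^sub>S b \<in> plane a"
      unfolding span_insert[of b] plane_eq by blast
    then have "(- k) *\<^sub>S b + 1 *\<^sub>S (a \<star> b) + 0 *\<^sub>S (b \<star> a) + 0 *\<^sub>S (b \<star> (a \<star> a)) \<in> plane a" by simp
    then show False using independent_mod_plane(2)[OF a b] by fastforce
  qed
  have ba: "b \<star> a \<notin> span {a \<star> b, b, a \<star> a, a}"
  proof
    assume "b \<star> a \<in> span {a \<star> b, b, a \<star> a, a}"
    then obtain j k where "b \<star> a - j *\<^sub>S (a \<star> b) - k *\<^sub>S b \<in> plane a"
      unfolding span_insert[of "a \<star> b"] span_insert[of b] plane_eq by blast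
    then have "(- k) *\<^sub>S b + (- j) *\<^sub>S (a \<star> b) + 1 *\<^sub>S (b \<star> a) + 0 *\<^sub>S (b \<star> (a \<star> a)) \<in> plane a"
      by (simp add: algebra_simps)
    then show False using independent_mod_plane(3)[OF a b] by fastforce
  qed
  have bb: "b \<star> b \<notin> span {b \<star> a, a \<star> b, b, a \<star> a, a}"
  proof
    assume "b \<star> b \<in> span {b \<star> a, a \<star> b, b, a \<star> a, a}"
    then obtain i j k where "b \<star> b - i *\<^sub>S (b \<star> a) - j *\<^sub>S (a \<star> b) - k *\<^sub>S b \<in> plane a"
      unfolding span_insert[of "b \<star> a"] span_insert[of "a \<star> b"] span_insert[of b] plane_eq by blast
    then obtain m l where
      "b \<star> b - i *\<^sub>S (b \<star> a) - j *\<^sub>S (a \<star> b) - k *\<^sub>S b = m *\<^sub>S a + l *\<^sub>S (a \<star> a)"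
      unfolding in_plane_iff by blast
    then have "b \<star> b = m *\<^sub>S a + l *\<^sub>S (a \<star> a) + k *\<^sub>S b + j *\<^sub>S (a \<star> b) + i *\<^sub>S (b \<star> a)"
      by (simp add: algebra_simps)
    then show False using square_notin[OF a b] by blast
  qed
  show ?ind
    using a by (intro independent_insertI[OF bb] independent_insertI[OF ba] independent_insertI[OF ab]
        independent_insertI[OF b'] independent_insertI[OF aa]) simp
  have "x \<notin> S" if "x \<notin> span S" for x S using that span_base by blast
  from this[OF aa] this[OF b'] this[OF ab] this[OF ba] this[OF bb] show ?card by simp
qed

lemma independent_left_right:
  assumes a: "a \<noteq> 0" and z: "z \<notin> plane a"
  shows "independent {z \<star> a, a \<star> z, z}" "card {z \<star> a, a \<star> z, z} = 3"
proof -
  have "{z \<star> a, a \<star> z, z} \<subseteq> {z \<star> z, z \<star> a, a \<star> z, z, a \<star> a, a}" by blast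
  then show "independent {z \<star> a, a \<star> z, z}"
    using independent_two_generators(1)[OF a z] independent_mono by blast
  show "card {z \<star> a, a \<star> z, z} = 3"
    using independent_two_generators(2)[OF a z] by (simp add: card_insert_if split: if_splits)
qed

text \<open>A unity would be an idempotent, hence zero. Consequently no word has length 0.\<close>

lemma no_unity: "\<not> is_unity e"
proof
  assume e: "is_unity e"
  then have "e = 0" using no_idempotent[of e] by (simp add: is_unity_def)
  then have "x = 0" for x :: 'v using e unfolding is_unity_def by (metis mult_zero_left)
  then show False using nontrivial by blast
qed

end

section \<open>Words of small length and words in subalgebras\<close>

context nonassoc_algebra
begin

lemma word_span_mono: "k \<le> k' \<Longrightarrow> word_span k S \<subseteq> word_span k' S"
  unfolding word_span_def by (intro span_mono Collect_mono) (meson order.trans)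

lemma word_in_word_span: "is_word S j w \<Longrightarrow> j \<le> k \<Longrightarrow> w \<in> word_span k S"
  unfolding word_span_def by (intro span_base) auto

lemma word_length_1:
  assumes "is_word S (Suc 0) w"
  shows "w \<in> S"
  using assms
proof cases
  case (product m x n y)
  then show ?thesis by linarith
qed simp

lemma word_length_2:
  assumes "is_word S 2 w"
  shows "\<exists>x\<in>S. \<exists>y\<in>S. w = x \<star> y"
  using assms
proof cases
  case (product m x n y)
  then have "m = Suc 0" "n = Suc 0" by linarith+
  then show ?thesis using product word_length_1 by blast
qed simp_all

lemma word_in_subalgebra:
  assumes "S \<subseteq> A" "\<And>x y. x \<in> A \<Longrightarrow> y \<in> A \<Longrightarrow> x \<star> y \<in> A" "\<And>e. \<not> is_unity e"
  shows "is_word S k w \<Longrightarrow> w \<in> A"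
  by (induction rule: is_word.induct) (use assms in auto)

end

text \<open>The form in which the Okubo algebra enters the length computation: an anisotropic
  symmetric composition algebra of dimension 8.\<close>

locale division_okubo = anisotropic_symmetric_composition scale mult q +
  finite_dimensional_vector_space scale Basis
  for scale :: "'f::field \<Rightarrow> 'v::ab_group_add \<Rightarrow> 'v" (infixr \<open>*\<^sub>S\<close> 75)
    and mult :: "'v \<Rightarrow> 'v \<Rightarrow> 'v" (infixl \<open>\<star>\<close> 70)
    and q :: "'v \<Rightarrow> 'f" and Basis :: "'v set" +
  assumes card_Basis: "card Basis = 8"
begin

lemma dim_UNIV_8: "dim UNIV = 8"
  by (simp add: card_Basis)

lemma polar_eq_0_span:
  assumes "\<And>t w. t \<in> T \<Longrightarrow> w \<in> W \<Longrightarrow> polar t w = 0" "y \<in> span T" "x \<in> span W"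
  shows "polar y x = 0"
proof -
  have zero_right: "polar t 0 = 0" for t using polar_commute[of t 0] by simp
  have "polar t x = 0" if "t \<in> T" for t
    using assms(3) by (induction rule: span_induct_alt)
      (auto simp: assms(1) that polar_add_right polar_scale_right zero_right)
  with assms(2) show ?thesis
    by (induction rule: span_induct_alt) (auto simp: polar_add_left polar_scale_left)
qed

text \<open>Pairing \<open>y\<close> with \<open>y \<star> y\<close> gives \<open>cubic y\<close>,
  nonzero for nonzero \<open>y\<close>. This works in characteristic 2 too, where
  \<open>polar y y = 0\<close>.\<close>

lemma polar_nondegenerate:
  assumes "\<And>w. w \<in> W \<Longrightarrow> polar y w = 0" "span W = UNIV"
  shows "y = 0"
  using polar_eq_0_span[of "{y}" W y "y \<star> y"] assms cubic_nonzero[of y]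
  by (auto simp: cubic_def span_base)

lemma word_span_3:
  assumes a: "a \<noteq> 0" and b: "b \<notin> plane a" and S: "a \<in> S" "b \<in> S"
  shows "word_span 3 S = UNIV"
proof (rule ccontr)
  let ?U = "word_span 3 S"
  assume U: "?U \<noteq> UNIV"
  have subspU: "subspace ?U" by (simp add: word_span_def)
  obtain C where C: "C \<subseteq> ?U" "independent C" "?U \<subseteq> span C" "card C = dim ?U"
    using basis_exists by blast
  have "dim ?U \<noteq> dimension"
    using U subspU dim_eq_full[of ?U] by (simp add: span_eq_iff[THEN iffD2])
  then have "card C < card Basis"
    using C(4) dim_subset_UNIV[of ?U] by (simp add: dimension_def)
  \<comment> \<open>A basis of the proper subspace \<open>?U\<close> gives fewer than eight
    functionals, so they have a common nonzero kernel vector.\<close>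
  then obtain z where z: "z \<noteq> 0" "\<And>c. c \<in> C \<Longrightarrow> polar z c = 0"
    using exists_common_kernel_vector[OF finiteI_independent[OF C(2)] independent_Basis,
        of "\<lambda>c x. polar x c"]
    by (auto simp: polar_add_left polar_scale_left)
  have perp: "polar z w = 0" if "w \<in> ?U" for w
    using polar_eq_0_span[of "{z}" C z w] z(2) that C(3) by (auto simp: span_base)
  have letter: "is_word S 1 a" "is_word S 1 b" by (rule is_word.letter[OF S(1)], rule is_word.letter[OF S(2)])
  have w2: "is_word S 2 (x \<star> y)" if "x \<in> {a, b}" "y \<in> {a, b}" for x y
  proof -
    have "is_word S 1 x" "is_word S 1 y" using that letter by blast+
    from is_word.product[OF this] show ?thesis by (simp add: numeral_2_eq_2)
  qed
  have w3: "is_word S 3 (x \<star> w) \<and> is_word S 3 (w \<star> x)"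
    if "x \<in> {a, b}" "is_word S 2 w" for x w
  proof -
    have "is_word S 1 x" using that letter by blast
    from is_word.product[OF this that(2)] is_word.product[OF that(2) this]
    show ?thesis by (simp add: numeral_2_eq_2 numeral_3_eq_3)
  qed
  define W where "W = {b \<star> b, b \<star> a, a \<star> b, b, a \<star> a, a}"
  have W: "w \<in> ?U \<and> w \<star> a \<in> ?U \<and> a \<star> w \<in> ?U" if "w \<in> W" for w
  proof -
    have "is_word S 1 w \<and> w \<in> {a, b} \<or> is_word S 2 w"
      using that w2 letter unfolding W_def by blast
    then show ?thesis
    proof
      assume "is_word S 1 w \<and> w \<in> {a, b}"
      then show ?thesis using w2[of w a] w2[of a w]
        by (auto intro: word_in_word_span[of S 1] word_in_word_span[of S 2])
    next
      assume "is_word S 2 w"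
      then show ?thesis using w3[of a w]
        by (auto intro: word_in_word_span[of S 2] word_in_word_span[of S 3])
    qed
  qed
  \<comment> \<open>The plane lies in \<open>?U\<close>, so a \<open>z\<close> inside it would be
    orthogonal to \<open>z \<star> z\<close>.\<close>
  have "z \<notin> plane a"
  proof
    assume "z \<in> plane a"
    then have "z \<star> z \<in> plane a" using plane_mult by blast
    also have "plane a \<subseteq> ?U"
      unfolding plane_def using W subspU by (intro span_minimal) (auto simp: W_def)
    finally show False using perp cubic_nonzero[OF z(1)] by (simp add: cubic_def)
  qed
  note T = independent_left_right[OF a this]
  have TW: "polar t w = 0" if "t \<in> {z \<star> a, a \<star> z, z}" "w \<in> W" for t w
  proof -
    have "polar z w = 0" "polar z (w \<star> a) = 0" "polar z (a \<star> w) = 0"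
      using W[OF that(2)] by (blast intro: perp)+
    \<comment> \<open>Cyclicity shifts the factor \<open>a\<close> from \<open>z\<close> to
      \<open>w\<close>, which turns \<open>w\<close> into a word of length at most 3.\<close>
    moreover have "polar (a \<star> z) w = polar z (w \<star> a)" "polar (z \<star> a) w = polar z (a \<star> w)"
      by (metis polar_cyclic polar_commute)+
    ultimately show ?thesis using that(1) by auto
  qed
  \<comment> \<open>Nondegeneracy is used by counting: a basis \<open>D\<close> has only two vectors
    outside \<open>W\<close>, so three independent vectors orthogonal to \<open>W\<close> have a
    nonzero combination \<open>y\<close> orthogonal to all of \<open>D\<close>.\<close>
  obtain D where D: "W \<subseteq> D" "independent D" "UNIV \<subseteq> span D"
    using maximal_independent_subset_extend[of W UNIV] independent_two_generators(1)[OF a b]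
    unfolding W_def by auto
  have "card D = 8" using basis_card_eq_dim[of D UNIV] D dim_UNIV_8 by simp
  moreover have "card W = 6" using independent_two_generators(2)[OF a b] by (simp add: W_def)
  ultimately have "card (D - W) = 2" "finite (D - W)"
    using D(1) finiteI_independent[OF D(2)] by (auto simp: card_Diff_subset finite_subset)
  then obtain y where y: "y \<in> span {z \<star> a, a \<star> z, z}" "y \<noteq> 0" "\<And>c. c \<in> D - W \<Longrightarrow> polar y c = 0"
    using exists_common_kernel_vector[OF _ T(1), of "D - W" "\<lambda>c x. polar x c"] T(2)
    by (auto simp: polar_add_left polar_scale_left)
  have "polar y w = 0" if "w \<in> W" for w
    using polar_eq_0_span[OF TW y(1) span_base[OF that]] .
  then have "polar y w = 0" if "w \<in> D" for w using y(3) that by blast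
  then show False using polar_nondegenerate[of D y] D(3) y(2) by blast
qed

text \<open>Two letters give at most six words of length 1 or 2, too few for dimension 8.\<close>

lemma word_span_2:
  assumes "S = {a, b}"
  shows "word_span 2 S \<noteq> UNIV"
proof
  assume UNIV: "word_span 2 S = UNIV"
  let ?W = "{b \<star> b, b \<star> a, a \<star> b, b, a \<star> a, a}"
  have "w \<in> ?W" if w: "is_word S j w" "j \<le> 2" for j w
  proof -
    have "j \<noteq> 0"
    proof
      assume "j = 0"
      with w(1) show False by cases (auto simp: no_unity)
    qed
    then consider "j = Suc 0" | "j = 2" using w(2) by linarith
    then show ?thesis
      using w(1) word_length_1 word_length_2 assms by cases blast+
  qed
  then have "word_span 2 S \<subseteq> span ?W"
    unfolding word_span_def by (intro span_mono) auto
  then have "dim (UNIV :: 'v set) \<le> card ?W"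
    unfolding UNIV by (intro dim_le_card) auto
  also have "card ?W \<le> 6"
    by (intro order.trans[OF card_insert_le_m1] card_insert_le_m1) simp_all
  finally show False by (simp add: dim_UNIV_8[simplified])
qed

lemma plane_neq_UNIV: "plane a \<noteq> UNIV"
proof
  assume "plane a = UNIV"
  then have "dim (UNIV :: 'v set) \<le> card {a, a \<star> a}"
    unfolding plane_def by (intro dim_le_card) auto
  also have "\<dots> \<le> 2" by (simp add: card_insert_if)
  finally show False by (simp add: dim_UNIV_8[simplified])
qed

text \<open>\<open>plane a\<close> is a proper subalgebra, so words in its elements never leave
  it.\<close>

lemma generating_not_in_plane:
  assumes "generating S"
  shows "\<not> S \<subseteq> plane a"
proof
  assume "S \<subseteq> plane a"
  then have "is_word S k w \<Longrightarrow> w \<in> plane a" for k w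
    using word_in_subalgebra plane_mult no_unity by blast
  then have "word_span k S \<subseteq> plane a" for k
    unfolding word_span_def using subspace_plane by (intro span_minimal) auto
  then have "word_span_inf S \<subseteq> plane a"
    unfolding word_span_inf_def by blast
  then show False using assms plane_neq_UNIV by (auto simp: generating_def)
qed

theorem algebra_length_eq_3: "algebra_length = 3"
proof -
  have upper: "set_length S \<le> 3" if S: "generating S" for S
  proof -
    \<comment> \<open>Any \<open>plane a0\<close> contains 0, so an element of \<open>S\<close>
      outside it is a nonzero letter.\<close>
    obtain a0 :: 'v where "a0 \<noteq> 0" using nontrivial by blast
    have "0 \<in> plane a0" using subspace_0[OF subspace_plane] .
    then obtain a where a: "a \<in> S" "a \<noteq> 0"
      using generating_not_in_plane[OF S, of a0] by fastforce
    obtain b where b: "b \<in> S" "b \<notin> plane a"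
      using generating_not_in_plane[OF S] by blast
    have "word_span 3 S = word_span_inf S"
      using word_span_3[OF a(2) b(2) a(1) b(1)] S by (simp add: generating_def)
    then show ?thesis unfolding set_length_def by (rule Least_le)
  qed
  \<comment> \<open>The bound is attained by two letters \<open>a\<close> and \<open>b\<close> with
    \<open>b\<close> outside \<open>plane a\<close>.\<close>
  obtain a :: 'v where a: "a \<noteq> 0" using nontrivial by blast
  obtain b where b: "b \<notin> plane a" using plane_neq_UNIV by blast
  have w3: "word_span 3 {a, b} = UNIV" using word_span_3[OF a b] by simp
  then have inf: "word_span_inf {a, b} = UNIV" unfolding word_span_inf_def by blast
  have "set_length {a, b} = 3"
    unfolding set_length_def inf
  proof (rule Least_equality)
    show "word_span 3 {a, b} = UNIV" by (rule w3)
    show "3 \<le> k" if "word_span k {a, b} = UNIV" for k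
    proof (rule ccontr)
      assume "\<not> 3 \<le> k"
      then have "word_span k {a, b} \<subseteq> word_span 2 {a, b}" by (intro word_span_mono) simp
      then show False using that word_span_2[OF refl, of a b] by blast
    qed
  qed
  then have mem: "3 \<in> {set_length S | S. generating S}"
    using inf unfolding generating_def by force
  show ?thesis
    unfolding algebra_length_def
  proof (rule Max_eqI)
    show "finite {set_length S | S. generating S}"
      by (rule finite_subset[of _ "{..3}"]) (use upper in auto)
  qed (use upper mem in auto)
qed

end

section \<open>The norm of the split Okubo algebra\<close>

definition okubo_coord :: "'k ^ okubo_index \<Rightarrow> int \<Rightarrow> int \<Rightarrow> 'k::field"
  where "okubo_coord x i j = x $ Abs_okubo_index (i, j)"

text \<open>The hyperbolic form that pairs each basis vector with its bar.\<close>

definition okubo_norm :: "'k::field ^ okubo_index \<Rightarrow> 'k"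
  where "okubo_norm x =
    okubo_coord x 1 0 * okubo_coord x (-1) 0 + okubo_coord x 0 1 * okubo_coord x 0 (-1) +
    okubo_coord x 1 1 * okubo_coord x (-1) (-1) + okubo_coord x 1 (-1) * okubo_coord x (-1) 1"

definition okubo_pairs :: "(int \<times> int) set"
  where "okubo_pairs = {(1, 0), (-1, 0), (0, 1), (0, -1), (1, 1), (-1, -1), (1, -1), (-1, 1)}"

lemma okubo_pairs_eq: "{-1, 0, 1} \<times> {-1, 0, 1} - {(0, 0)} = okubo_pairs"
  unfolding okubo_pairs_def by auto

lemmas okubo_index_type = type_definition_okubo_index[unfolded okubo_pairs_eq]

lemma UNIV_okubo_index: "(UNIV :: okubo_index set) = Abs_okubo_index ` okubo_pairs"
  by (rule type_definition.univ[OF okubo_index_type])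

lemma Rep_Abs_okubo_index: "p \<in> okubo_pairs \<Longrightarrow> Rep_okubo_index (Abs_okubo_index p) = p"
  by (rule type_definition.Abs_inverse[OF okubo_index_type])

lemma inj_on_Abs_okubo_index: "inj_on Abs_okubo_index okubo_pairs"
  by (rule inj_onI) (metis Rep_Abs_okubo_index)

lemma card_okubo_index: "CARD(okubo_index) = 8"
  unfolding UNIV_okubo_index card_image[OF inj_on_Abs_okubo_index] by (simp add: okubo_pairs_def)

lemma okubo_vec_eqI:
  assumes "\<And>i j. (i, j) \<in> okubo_pairs \<Longrightarrow> okubo_coord x i j = okubo_coord y i j"
  shows "x = y"
proof -
  have "x $ u = y $ u" for u
    using UNIV_I[of u] assms unfolding UNIV_okubo_index okubo_coord_def by fastforce
  then show ?thesis by (simp add: vec_eq_iff)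
qed

lemma okubo_basis_mult_nth:
  "okubo_basis_mult u v $ k =
    (if u = v then if okubo_bar u = k then -1 else 0
     else if okubo_related u v (okubo_bar k) then 1 else 0)"
proof -
  have bar_bar: "okubo_bar (okubo_bar w) = w" for w
  proof -
    have "Rep_okubo_index w \<in> okubo_pairs"
      by (rule type_definition.Rep[OF okubo_index_type])
    then have "map_prod uminus uminus (Rep_okubo_index w) \<in> okubo_pairs"
      unfolding okubo_pairs_def by auto
    then show ?thesis
      by (simp add: okubo_bar_def Rep_Abs_okubo_index prod.map_comp comp_def Rep_okubo_index_inverse
          map_prod.identity[unfolded id_def])
  qed
  show ?thesis
  proof (cases "u \<noteq> v \<and> (\<exists>w. okubo_related u v w)")
    case True
    then obtain w where w: "okubo_related u v w" by blast
    then have "{w'. okubo_related u v w'} = {w}"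
      using okubo_related_unique(2)[OF w] by blast
    moreover have "okubo_related u v (okubo_bar k) \<longleftrightarrow> okubo_bar w = k"
      using okubo_related_unique(2)[OF w] w bar_bar by metis
    ultimately show ?thesis
      using True by (simp add: okubo_basis_mult_def axis_def)
  next
    case False
    then show ?thesis by (auto simp: okubo_basis_mult_def axis_def intro!: sum.neutral)
  qed
qed

text \<open>Structure constants moved to pairs of integers, where rewriting can evaluate them; being
  integers they serve every field through \<open>of_int\<close>.\<close>

definition okubo_coef :: "int \<times> int \<Rightarrow> int \<times> int \<Rightarrow> int \<times> int \<Rightarrow> int"
  where "okubo_coef p q r =
    (if p = q then if map_prod uminus uminus p = r then -1 else 0
     else if (p, q, map_prod uminus uminus r) \<in> okubo_rotated_triples then 1 else 0)"

lemma okubo_coord_mult: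
  assumes "(i, j) \<in> okubo_pairs"
  shows "okubo_coord (okubo_mult x y) i j =
    (\<Sum>p\<in>okubo_pairs. \<Sum>q\<in>okubo_pairs.
      of_int (okubo_coef p q (i, j)) * (okubo_coord x (fst p) (snd p) * okubo_coord y (fst q) (snd q)))"
proof -
  have neg: "map_prod uminus uminus p \<in> okubo_pairs" if "p \<in> okubo_pairs" for p
    using that unfolding okubo_pairs_def by auto
  have Abs_eq: "Abs_okubo_index p = Abs_okubo_index q \<longleftrightarrow> p = q"
    if "p \<in> okubo_pairs" "q \<in> okubo_pairs" for p q
    using inj_on_eq_iff[OF inj_on_Abs_okubo_index that] .
  have coef: "okubo_basis_mult (Abs_okubo_index p) (Abs_okubo_index q) $ Abs_okubo_index (i, j)
      = (of_int (okubo_coef p q (i, j)) :: 'a)" if "p \<in> okubo_pairs" "q \<in> okubo_pairs" for p q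
    using that assms neg[OF assms] neg[OF that(1)] neg[OF that(2)]
    by (simp add: okubo_basis_mult_nth okubo_coef_def okubo_bar_def okubo_related_def
        Rep_Abs_okubo_index Abs_eq)
  show ?thesis
    unfolding okubo_coord_def okubo_mult_def UNIV_okubo_index
    by (simp add: sum.reindex[OF inj_on_Abs_okubo_index] coef cong: sum.cong) (simp add: mult_ac)
qed

text \<open>Every coordinate receives one square and three of the products given by the rotated
  triples.\<close>

lemma okubo_coord_mult_explicit:
  fixes x y :: "'k::field ^ okubo_index"
  defines "p \<equiv> okubo_coord x" and "q \<equiv> okubo_coord y"
  shows
    "okubo_coord (okubo_mult x y) 1 0 =
      - p (-1) 0 * q (-1) 0 + p 0 1 * q 1 (-1) + p 1 1 * q 0 (-1) + p (-1) 1 * q (-1) (-1)"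
    "okubo_coord (okubo_mult x y) (-1) 0 =
      - p 1 0 * q 1 0 + p 0 (-1) * q (-1) 1 + p (-1) (-1) * q 0 1 + p 1 (-1) * q 1 1"
    "okubo_coord (okubo_mult x y) 0 1 =
      - p 0 (-1) * q 0 (-1) + p (-1) 1 * q 1 0 + p (-1) 0 * q 1 1 + p (-1) (-1) * q 1 (-1)"
    "okubo_coord (okubo_mult x y) 0 (-1) =
      - p 0 1 * q 0 1 + p 1 0 * q (-1) (-1) + p 1 (-1) * q (-1) 0 + p 1 1 * q (-1) 1"
    "okubo_coord (okubo_mult x y) 1 1 =
      - p (-1) (-1) * q (-1) (-1) + p 0 1 * q 1 0 + p (-1) 0 * q (-1) 1 + p 1 (-1) * q 0 (-1)"
    "okubo_coord (okubo_mult x y) (-1) (-1) =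
      - p 1 1 * q 1 1 + p 1 0 * q 1 (-1) + p 0 (-1) * q (-1) 0 + p (-1) 1 * q 0 1"
    "okubo_coord (okubo_mult x y) 1 (-1) =
      - p (-1) 1 * q (-1) 1 + p 1 0 * q 0 (-1) + p (-1) (-1) * q (-1) 0 + p 0 1 * q 1 1"
    "okubo_coord (okubo_mult x y) (-1) 1 =
      - p 1 (-1) * q 1 (-1) + p 1 1 * q 1 0 + p (-1) 0 * q 0 1 + p 0 (-1) * q (-1) (-1)"
  unfolding p_def q_def
  by (subst okubo_coord_mult;
      simp add: okubo_pairs_def okubo_coef_def okubo_rotated_triples_def okubo_triples_def)+

text \<open>In coordinates these are polynomial identities with integer coefficients, so plain
  expansion proves them in every characteristic.\<close>

lemma okubo_mult_sandwich:
  fixes x y :: "'k::field ^ okubo_index"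
  shows "okubo_mult (okubo_mult x y) x = okubo_norm x *s y"
    and "okubo_mult x (okubo_mult y x) = okubo_norm x *s y"
proof -
  have sc: "okubo_coord (c *s y) i j = c * okubo_coord y i j" for c i j
    by (simp add: okubo_coord_def)
  show "okubo_mult (okubo_mult x y) x = okubo_norm x *s y"
    "okubo_mult x (okubo_mult y x) = okubo_norm x *s y"
    by (rule okubo_vec_eqI; unfold okubo_pairs_def; elim insertE emptyE;
        clarsimp simp: okubo_coord_mult_explicit okubo_norm_def sc; simp add: algebra_simps)+
qed

section \<open>Descent from the algebraic closure\<close>

context nonassoc_algebra
begin

text \<open>\<open>f\<close> tensored with the identity of the closure, on representatives. For
  linear \<open>f\<close> it vanishes on \<open>tensor_null\<close>, which gives a way to show that
  a formal sum is not null.\<close>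

definition ext_functional :: "('v \<Rightarrow> 'f) \<Rightarrow> ('v \<Rightarrow>\<^sub>0 'f alg_closure) \<Rightarrow> 'f alg_closure"
  where "ext_functional f p =
    (\<Sum>v\<in>Poly_Mapping.keys p. to_ac (f v) * Poly_Mapping.lookup p v)"

lemma ext_functional_superset:
  assumes "finite A" "Poly_Mapping.keys p \<subseteq> A"
  shows "ext_functional f p = (\<Sum>v\<in>A. to_ac (f v) * Poly_Mapping.lookup p v)"
  unfolding ext_functional_def
  by (rule sum.mono_neutral_left) (use assms in \<open>auto simp: in_keys_iff\<close>)

lemma ext_functional_single: "ext_functional f (Poly_Mapping.single v c) = to_ac (f v) * c"
  by (subst ext_functional_superset[of "{v}"]) auto

lemma ext_functional_diff: "ext_functional f (p - p') = ext_functional f p - ext_functional f p'"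
proof -
  let ?A = "Poly_Mapping.keys p \<union> Poly_Mapping.keys p' \<union> Poly_Mapping.keys (p - p')"
  have "ext_functional f r = (\<Sum>v\<in>?A. to_ac (f v) * Poly_Mapping.lookup r v)"
    if "r \<in> {p, p', p - p'}" for r
    by (rule ext_functional_superset) (use that in auto)
  then show ?thesis
    by (simp add: lookup_minus right_diff_distrib sum_subtractf)
qed

lemma ext_functional_add: "ext_functional f (p + p') = ext_functional f p + ext_functional f p'"
  using ext_functional_diff[of f "p + p'" p'] by (simp add: eq_diff_eq)

lemma ext_functional_zero: "ext_functional f 0 = 0"
  by (simp add: ext_functional_def)

lemma ext_functional_sum_single:
  "ext_functional f (\<Sum>v\<in>A. Poly_Mapping.single v (c v)) = (\<Sum>v\<in>A. to_ac (f v) * c v)"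
  by (induction A rule: infinite_finite_induct)
    (simp_all add: ext_functional_zero ext_functional_add ext_functional_single)

lemma ext_functional_null:
  assumes f_add: "\<And>u v. f (u + v) = f u + f v" and f_scale: "\<And>a u. f (a *\<^sub>S u) = a * f u"
  shows "p \<in> tensor_null \<Longrightarrow> ext_functional f p = 0"
proof (induction rule: tensor_null.induct)
  case zero
  then show ?case by (rule ext_functional_zero)
qed (simp_all add: ext_functional_diff ext_functional_single f_add f_scale distrib_right)

end

locale okubo_algebra_iso = nonassoc_algebra scale mult
  for scale :: "'f::field \<Rightarrow> 'v::ab_group_add \<Rightarrow> 'v" (infixr \<open>*\<^sub>S\<close> 75)
    and mult :: "'v \<Rightarrow> 'v \<Rightarrow> 'v" (infixl \<open>\<star>\<close> 70) +
  fixes \<phi> :: "('v \<Rightarrow>\<^sub>0 'f alg_closure) set \<Rightarrow> 'f alg_closure ^ okubo_index"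
  assumes bij: "bij_betw \<phi> ext_carrier UNIV"
    and ext_add: "A \<in> ext_carrier \<Longrightarrow> B \<in> ext_carrier \<Longrightarrow> \<phi> (ext_add A B) = \<phi> A + \<phi> B"
    and ext_scale: "A \<in> ext_carrier \<Longrightarrow> \<phi> (ext_scale c A) = c *s \<phi> A"
    and ext_mult: "A \<in> ext_carrier \<Longrightarrow> B \<in> ext_carrier \<Longrightarrow>
      \<phi> (ext_mult A B) = okubo_mult (\<phi> A) (\<phi> B)"
begin

section \<open>The algebra inside its scalar extension\<close>

lemma class_in_carrier: "tensor_class p \<in> ext_carrier"
  by (simp add: ext_carrier_def)

definition emb :: "'v \<Rightarrow> 'f alg_closure ^ okubo_index"
  where "emb v = \<phi> (tensor_class (Poly_Mapping.single v 1))"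

lemma class_add: "\<phi> (tensor_class (p + p')) = \<phi> (tensor_class p) + \<phi> (tensor_class p')"
  using ext_add[OF class_in_carrier class_in_carrier] by (simp add: ext_add_class)

lemma class_zero: "\<phi> (tensor_class 0) = 0"
  using class_add[of 0 0] by simp

lemma class_single: "\<phi> (tensor_class (Poly_Mapping.single v c)) = c *s emb v"
  using ext_scale[OF class_in_carrier, of c "Poly_Mapping.single v 1"]
  by (simp add: ext_scale_class formal_scale_single emb_def)

lemma class_sum_single:
  "\<phi> (tensor_class (\<Sum>v\<in>A. Poly_Mapping.single v (c v))) = (\<Sum>v\<in>A. c v *s emb v)"
  by (induction A rule: infinite_finite_induct) (simp_all add: class_zero class_add class_single)

lemma class_eq_0_iff: "\<phi> (tensor_class p) = 0 \<longleftrightarrow> p \<in> tensor_null"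
proof -
  have "\<phi> (tensor_class p) = \<phi> (tensor_class 0) \<longleftrightarrow> tensor_class p = tensor_class 0"
    using bij_betw_imp_inj_on[OF bij] class_in_carrier by (simp add: inj_on_eq_iff)
  then show ?thesis by (simp add: class_zero tensor_class_eq_iff)
qed

lemma emb_add: "emb (u + v) = emb u + emb v"
proof -
  have "tensor_class (Poly_Mapping.single (u + v) 1) =
      tensor_class (Poly_Mapping.single u 1 + Poly_Mapping.single v 1)"
    using tensor_null.additive[of u v 1] by (simp add: tensor_class_eq_iff diff_diff_eq)
  then show ?thesis by (simp add: emb_def class_add)
qed

lemma emb_scale: "emb (a *\<^sub>S v) = to_ac a *s emb v"
proof -
  have "tensor_class (Poly_Mapping.single (a *\<^sub>S v) 1) = tensor_class (Poly_Mapping.single v (to_ac a))"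
    using tensor_null.balanced[of a v 1] by (simp add: tensor_class_eq_iff)
  then show ?thesis using class_single[of v "to_ac a"] by (simp add: emb_def)
qed

lemma emb_mult: "emb (u \<star> v) = okubo_mult (emb u) (emb v)"
proof -
  have "ext_mult (tensor_class (Poly_Mapping.single u 1)) (tensor_class (Poly_Mapping.single v 1)) =
      tensor_class (Poly_Mapping.single (u \<star> v) 1)"
    by (simp add: ext_mult_class formal_mult_single_left)
  then show ?thesis
    using ext_mult[OF class_in_carrier class_in_carrier] unfolding emb_def by metis
qed

lemma emb_zero: "emb 0 = 0"
  using emb_add[of 0 0] by simp

text \<open>Independence survives extension of scalars: the coordinate functional of
  \<open>b\<close> for a basis extending \<open>B\<close>, applied to the null formal sum, reads off
  \<open>c b\<close>.\<close>

lemma emb_independent: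
  assumes B: "independent B" "finite B" and c: "(\<Sum>b\<in>B. c b *s emb b) = 0" and b: "b \<in> B"
  shows "c b = 0"
proof -
  let ?p = "\<Sum>b\<in>B. Poly_Mapping.single b (c b)"
  let ?B = "extend_basis B"
  define f where "f v = representation ?B v b" for v
  have ind: "independent ?B" and span: "v \<in> span ?B" for v
    using independent_extend_basis[OF B(1)] span_extend_basis[OF B(1)] by simp_all
  have "?p \<in> tensor_null" using c by (simp add: class_eq_0_iff[symmetric] class_sum_single)
  then have "ext_functional f ?p = 0"
    by (rule ext_functional_null[rotated -1])
      (simp_all add: f_def representation_add[OF ind span span] representation_scale[OF ind span])
  moreover have "(\<Sum>b'\<in>B. to_ac (f b') * c b') = (\<Sum>b'\<in>B. if b' = b then c b else 0)"
    using extend_basis_superset[OF B(1)]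
    by (intro sum.cong) (auto simp: f_def representation_basis[OF ind])
  ultimately show ?thesis using B(2) b by (simp add: ext_functional_sum_single)
qed

text \<open>This is how scalars descend to the ground field: independent \<open>v\<close> and
  \<open>w\<close> would stay independent over the closure, so \<open>v\<close> is already a
  multiple of \<open>w\<close>.\<close>

lemma emb_eq_scale:
  assumes w: "w \<noteq> 0" and eq: "emb v = c *s emb w"
  shows "\<exists>d. c = to_ac d \<and> v = d *\<^sub>S w"
proof -
  have "v \<in> span {w}"
  proof (rule ccontr)
    assume v: "v \<notin> span {w}"
    then have "v \<noteq> w" using span_base[of w "{w}"] by blast
    moreover have "independent {v, w}" using independent_insertI[OF v] w by simp
    ultimately show False
      using emb_independent[of "{v, w}" "\<lambda>b. if b = v then 1 else - c" v] eq by simp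
  qed
  then obtain d where d: "v = d *\<^sub>S w" unfolding span_singleton by blast
  have "emb w \<noteq> 0" using emb_independent[of "{w}" "\<lambda>_. 1" w] w by auto
  then have "c = to_ac d" using eq by (simp add: d emb_scale)
  with d show ?thesis by blast
qed

lemma emb_in_span: "v \<in> span B \<Longrightarrow> emb v \<in> vec.span (emb ` B)"
  by (induction rule: span_induct_alt)
    (auto simp: emb_zero emb_add emb_scale intro: vec.span_add vec.span_scale vec.span_base vec.span_zero)

lemma span_emb:
  assumes "span B = UNIV"
  shows "vec.span (emb ` B) = UNIV"
proof -
  have "x \<in> vec.span (emb ` B)" for x
  proof -
    obtain p where p: "x = \<phi> (tensor_class p)"
      using bij UNIV_I[of x] unfolding bij_betw_def ext_carrier_def by blast
    have "p = (\<Sum>v\<in>Poly_Mapping.keys p. Poly_Mapping.single v (Poly_Mapping.lookup p v))"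
      by (rule poly_mapping_eqI) (auto simp: lookup_sum lookup_single when_def in_keys_iff)
    then have "x = (\<Sum>v\<in>Poly_Mapping.keys p. Poly_Mapping.lookup p v *s emb v)"
      using p class_sum_single by metis
    then show ?thesis
      using emb_in_span[of _ B] assms by (auto intro!: vec.span_sum vec.span_scale)
  qed
  then show ?thesis by blast
qed

lemma card_independent_le:
  assumes "independent B" "finite B"
  shows "card B \<le> 8"
proof -
  have inj: "inj_on emb B"
  proof
    fix u v assume uv: "u \<in> B" "v \<in> B" "emb u = emb v"
    show "u = v"
    proof (rule ccontr)
      assume "u \<noteq> v"
      then have "(\<Sum>b\<in>B. (if b = u then 1 else if b = v then - 1 else 0) *s emb b) =
          (\<Sum>b\<in>{u, v}. (if b = u then 1 else if b = v then - 1 else 0) *s emb b)"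
        using assms(2) uv by (intro sum.mono_neutral_right) auto
      then show False
        using emb_independent[OF assms, of "\<lambda>b. if b = u then 1 else if b = v then - 1 else 0" u]
          uv \<open>u \<noteq> v\<close> by auto
    qed
  qed
  have "vec.independent (emb ` B)"
  proof (rule vec.independent_if_scalars_zero)
    show "finite (emb ` B)" using assms(2) by simp
    fix f x assume f: "(\<Sum>x\<in>emb ` B. f x *s x) = 0" and x: "x \<in> emb ` B"
    then obtain b where "b \<in> B" "x = emb b" by blast
    then show "f x = 0"
      using emb_independent[OF assms, of "f \<circ> emb" b] f by (simp add: sum.reindex[OF inj])
  qed
  then have "card (emb ` B) \<le> vec.dim (UNIV :: ('f alg_closure ^ okubo_index) set)"
    by (intro vec.independent_card_le_dim) auto
  then show ?thesis unfolding vec_dim_card card_okubo_index card_image[OF inj] .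
qed

text \<open>Independent sets map to independent sets, bounding the dimension above by 8; spanning
  sets map to spanning sets, bounding it below.\<close>

lemma basis_8:
  obtains B where "finite B" "independent B" "span B = UNIV" "card B = 8"
proof -
  obtain B :: "'v set" where B: "independent B" "UNIV \<subseteq> span B"
    using maximal_independent_subset[of UNIV] by blast
  have fin: "finite B"
  proof (rule ccontr)
    assume "infinite B"
    then obtain C where "finite C" "card C = 9" "C \<subseteq> B"
      using infinite_arbitrarily_large by blast
    then show False using card_independent_le[of C] independent_mono[OF B(1)] by simp
  qed
  have "vec.dim (UNIV :: ('f alg_closure ^ okubo_index) set) \<le> card (emb ` B)"
    using span_emb[of B] B(2) fin by (intro vec.dim_le_card) auto
  then have "8 \<le> card B"
    unfolding vec_dim_card card_okubo_index using card_image_le[OF fin, of emb] by simp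
  then show ?thesis
    using that[OF fin B(1)] B(2) card_independent_le[OF B(1) fin] by auto
qed

text \<open>The factor \<open>okubo_norm (emb x)\<close> lies a priori in the closure. Comparison at
  one nonzero \<open>w\<close> shows that it comes from the ground field, and the same scalar then
  works for all \<open>y\<close>.\<close>

lemma composition_norm:
  "\<exists>q. \<forall>x y. (x \<star> y) \<star> x = q x *\<^sub>S y \<and> x \<star> (y \<star> x) = q x *\<^sub>S y"
proof -
  have "\<exists>d. \<forall>y. (x \<star> y) \<star> x = d *\<^sub>S y \<and> x \<star> (y \<star> x) = d *\<^sub>S y" for x
  proof -
    obtain B :: "'v set" where B: "independent B" "card B = 8" by (rule basis_8)
    then obtain w where "w \<in> B" by fastforce
    then have w: "w \<noteq> 0" using B(1) dependent_zero by blast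
    have emb: "emb ((x \<star> y) \<star> x) = okubo_norm (emb x) *s emb y"
      "emb (x \<star> (y \<star> x)) = okubo_norm (emb x) *s emb y" for y
      by (simp_all only: emb_mult okubo_mult_sandwich)
    obtain d where d: "okubo_norm (emb x) = to_ac d"
      using emb_eq_scale[OF w emb(1)] by blast
    have zero: "u = 0" if "emb u = 0" for u
      using emb_eq_scale[OF w, of u 0] that by auto
    have "(x \<star> y) \<star> x = d *\<^sub>S y \<and> x \<star> (y \<star> x) = d *\<^sub>S y" for y
    proof (cases "y = 0")
      case True
      then show ?thesis by simp
    next
      case False
      show ?thesis
        using emb_eq_scale[OF False emb(1)] emb_eq_scale[OF False emb(2)] by (auto simp: d)
    qed
    then show ?thesis by blast
  qed
  then show ?thesis by metis
qed

end

theorem theorem4p21: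
  fixes scale :: "'f::field \<Rightarrow> 'v::ab_group_add \<Rightarrow> 'v"
    and mult :: "'v \<Rightarrow> 'v \<Rightarrow> 'v"
  assumes "okubo_algebra scale mult"
    and "\<not> (\<exists>c. c \<noteq> 0 \<and> nonassoc_algebra.is_idempotent mult c)"
    and "\<not> (\<exists>a. nonassoc_algebra.is_zero_divisor mult a)"
  shows "nonassoc_algebra.algebra_length scale mult = 3"
proof -
  interpret okubo_algebra scale mult by (rule assms(1))
  obtain \<phi> where "okubo_algebra_iso scale mult \<phi>"
    using ext_iso_split_okubo nonassoc_algebra_axioms
    unfolding okubo_algebra_iso_def okubo_algebra_iso_axioms_def by blast
  then interpret okubo_algebra_iso scale mult \<phi> .
  obtain B where B: "finite B" "independent B" "span B = UNIV" "card B = 8"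
    by (rule basis_8)
  obtain q where q: "\<And>x y. mult (mult x y) x = scale (q x) y"
      "\<And>x y. mult x (mult y x) = scale (q x) y"
    using composition_norm by blast
  have "B \<noteq> {}" "0 \<notin> B" using B(2,4) dependent_zero by auto
  then have nontrivial: "\<exists>x::'v. x \<noteq> 0" by (metis ex_in_conv)
  \<comment> \<open>The excluded idempotents and zero divisors become \<open>no_idempotent\<close>
    and \<open>no_zero_divisor\<close>; \<open>q\<close> is the descended norm.\<close>
  interpret division_okubo scale mult q B
    by unfold_locales
      (use B q nontrivial assms(2,3) in \<open>auto simp: is_idempotent_def is_zero_divisor_def\<close>)
  show ?thesis by (rule algebra_length_eq_3)
qed

end
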